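(* Let $\Psi\colon \mathbb{N}\to(0,\infty)$. (i) If $\sum_{m=1}^\infty \Psi(m)^4\, m^7<\infty$, then $\mathcal{W}(\Psi)$ and $\mathcal{V}(\Psi)$ are null. (ii) If $\Psi$ is decreasing and $\sum_{m=1}^\infty \Psi(m)^4\, m^7=\infty$, then $\mathcal{W}(\Psi)$ is full (in $\mathbb{H}$) and $\mathcal{V}(\Psi)$ is full (in $\overline\Delta$).
   Context: $\mathbb{H}$ denotes the real quaternions $\xi=a+bi+cj+dk$, identified with $\mathbb{R}^4$, with Euclidean norm $|\xi|_2=(a^2+b^2+c^2+d^2)^{1/2}$ and $4$-dimensional Lebesgue measure $|\cdot|$. The Hurwitz integers $\mathcal{H}$ are the quaternions $a+bi+cj+dk$ with either all of $a,b,c,d\in\mathbb{Z}$ or all of $a,b,c,d\in\mathbb{Z}+\frac12$. Let $\overline\Delta=[0,1]^3\times[0,1/2]\subset\mathbb{H}$. A function $\Psi$ on $\mathbb{N}=\{1,2,\dots\}$ is extended to real $x\ge 1$ by $\Psi(x)=\Psi([x])$, $[x]$ being the integer part. Define $$\mathcal{W}(\Psi)=\{\xi\in\mathbb{H}: |\xi-\mathbf{p}\mathbf{q}^{-1}|_2<\Psi(|\mathbf{q}|_2)\text{ for infinitely many pairs }\mathbf{p},\mathbf{q}\in\mathcal{H},\ \mathbf{q}\ne0\}$$ (pairs $\mathbf{p},\mathbf{q}$ are not required to be coprime) and $\mathcal{V}(\Psi)=\mathcal{W}(\Psi)\cap\overline\Delta$. A set is null if its Lebesgue measure is $0$; $E\subseteq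 F$ is full in $F$ if $F\setminus E$ is null. "Decreasing" means non-increasing. *)

theory Defs
  imports "HOL-Analysis.Analysis"
begin

text \<open>
  The quaternion \<open>a + b i + c j + d k\<close> is the vector \<open>(a, b, c, d)\<close> of \<open>real ^ 4\<close>. Norm and
  Lebesgue measure are those of \<open>real ^ 4\<close>. The library's multiplication on \<open>real ^ 4\<close> is
  componentwise and its unit is \<open>(1, 1, 1, 1)\<close>, so the Hamilton product, its unit and its
  inverse are separate constants.
\<close>

type_synonym quat = "real ^ 4"

definition Quat :: "real \<Rightarrow> real \<Rightarrow> real \<Rightarrow> real \<Rightarrow> quat"
  where "Quat a b c d = vector [a, b, c, d]"

definition qmult :: "quat \<Rightarrow> quat \<Rightarrow> quat"  (infixl "\<cdot>\<^sub>H" 70)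
  where "x \<cdot>\<^sub>H y = Quat
    (x$1 * y$1 - x$2 * y$2 - x$3 * y$3 - x$4 * y$4)
    (x$1 * y$2 + x$2 * y$1 + x$3 * y$4 - x$4 * y$3)
    (x$1 * y$3 - x$2 * y$4 + x$3 * y$1 + x$4 * y$2)
    (x$1 * y$4 + x$2 * y$3 - x$3 * y$2 + x$4 * y$1)"

definition qone :: quat
  where "qone = Quat 1 0 0 0"

definition qcnj :: "quat \<Rightarrow> quat"
  where "qcnj x = Quat (x$1) (- x$2) (- x$3) (- x$4)"

definition qinv :: "quat \<Rightarrow> quat"
  where "qinv x = qcnj x /\<^sub>R (norm x)\<^sup>2"

lemma Quat_nth [simp]:
  "Quat a b c d $ 1 = a" "Quat a b c d $ 2 = b" "Quat a b c d $ 3 = c" "Quat a b c d $ 4 = d"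
  by (simp_all add: Quat_def vector_def)

lemma quat_eq_iff: "x = y \<longleftrightarrow> x$1 = y$1 \<and> x$2 = y$2 \<and> x$3 = y$3 \<and> x$4 = y$4" for x y :: quat
  by (simp add: vec_eq_iff forall_4)

lemma quat_norm_power2: "(norm x)\<^sup>2 = (x$1)\<^sup>2 + (x$2)\<^sup>2 + (x$3)\<^sup>2 + (x$4)\<^sup>2" for x :: quat
  by (simp only: power2_norm_eq_inner inner_vec_def sum_4) (simp add: power2_eq_square)

lemma qmult_units:
  "Quat 0 1 0 0 \<cdot>\<^sub>H Quat 0 0 1 0 = Quat 0 0 0 1"
  "Quat 0 0 1 0 \<cdot>\<^sub>H Quat 0 0 0 1 = Quat 0 1 0 0"
  "Quat 0 0 0 1 \<cdot>\<^sub>H Quat 0 1 0 0 = Quat 0 0 1 0"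
  "Quat 0 1 0 0 \<cdot>\<^sub>H Quat 0 1 0 0 = - qone"
  "Quat 0 0 1 0 \<cdot>\<^sub>H Quat 0 0 1 0 = - qone"
  "Quat 0 0 0 1 \<cdot>\<^sub>H Quat 0 0 0 1 = - qone"
  by (simp_all add: quat_eq_iff qmult_def qone_def)

lemma qmult_assoc: "(x \<cdot>\<^sub>H y) \<cdot>\<^sub>H z = x \<cdot>\<^sub>H (y \<cdot>\<^sub>H z)"
  by (simp add: quat_eq_iff qmult_def algebra_simps)

lemma qmult_qone: "x \<cdot>\<^sub>H qone = x" "qone \<cdot>\<^sub>H x = x"
  by (simp_all add: quat_eq_iff qmult_def qone_def)

lemma qmult_qcnj: "x \<cdot>\<^sub>H qcnj x = (norm x)\<^sup>2 *\<^sub>R qone" "qcnj x \<cdot>\<^sub>H x = (norm x)\<^sup>2 *\<^sub>R qone"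
  unfolding quat_eq_iff quat_norm_power2
  by (simp_all add: qmult_def qcnj_def qone_def power2_eq_square)

lemma qmult_scaleR: "(r *\<^sub>R x) \<cdot>\<^sub>H y = r *\<^sub>R (x \<cdot>\<^sub>H y)" "x \<cdot>\<^sub>H (r *\<^sub>R y) = r *\<^sub>R (x \<cdot>\<^sub>H y)"
  by (simp_all add: quat_eq_iff qmult_def algebra_simps)

lemma qmult_qinv:
  assumes "x \<noteq> 0"
  shows "x \<cdot>\<^sub>H qinv x = qone" "qinv x \<cdot>\<^sub>H x = qone"
  using assms by (simp_all add: qinv_def qmult_scaleR qmult_qcnj)

definition Hurwitz :: "quat set"
  where "Hurwitz = {x. (\<forall>i. x$i \<in> \<int>) \<or> (\<forall>i. x$i - 1/2 \<in> \<int>)}"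

lemma Hurwitz_norm_ge_1:
  assumes "x \<in> Hurwitz" "x \<noteq> 0"
  shows "norm x \<ge> 1"
proof -
  have "1 \<le> (norm x)\<^sup>2"
  proof (cases "\<forall>i. x$i \<in> \<int>")
    case True
    obtain i where "x$i \<noteq> 0"
      using assms(2) by (auto simp: vec_eq_iff)
    then have "1 \<le> \<bar>x$i\<bar>"
      using True Ints_nonzero_abs_ge1 by blast
    then have "1 \<le> norm x"
      using component_le_norm_cart order_trans by blast
    then show ?thesis
      by simp
  next
    case False
    then have half: "x$i - 1/2 \<in> \<int>" for i
      using assms(1) by (auto simp: Hurwitz_def)
    have "1/4 \<le> (x$i)\<^sup>2" for i
    proof -
      obtain n where n: "x$i - 1/2 = of_int n"
        using half Ints_cases by blast
      have "0 \<le> n \<or> n \<le> -1"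
        by linarith
      then have "0 \<le> real_of_int n \<or> real_of_int n \<le> -1"
        by linarith
      then have "1/2 \<le> \<bar>x$i\<bar>"
        using n by linarith
      then have "(1/2)\<^sup>2 \<le> \<bar>x$i\<bar>\<^sup>2"
        by (intro power_mono) auto
      then show ?thesis
        by (simp add: power2_eq_square)
    qed
    from this[of 1] this[of 2] this[of 3] this[of 4] show ?thesis
      unfolding quat_norm_power2 by linarith
  qed
  then show ?thesis
    using power2_less_imp_less[of "norm x" 1] abs_square_less_1[of "norm x"] by fastforce
qed

definition Delta_bar :: "quat set"
  where "Delta_bar = {x. x$1 \<in> {0..1} \<and> x$2 \<in> {0..1} \<and> x$3 \<in> {0..1} \<and> x$4 \<in> {0..1/2}}"

text \<open>Only arguments \<open>x \<ge> 1\<close> matter, by \<open>Hurwitz_norm_ge_1\<close>; \<open>\<Psi> 0\<close> is never used.\<close>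

definition real_ext :: "(nat \<Rightarrow> real) \<Rightarrow> real \<Rightarrow> real"
  where "real_ext \<Psi> x = \<Psi> (nat \<lfloor>x\<rfloor>)"

definition W_set :: "(nat \<Rightarrow> real) \<Rightarrow> quat set"
  where "W_set \<Psi> = {\<xi>. infinite {(p, q). p \<in> Hurwitz \<and> q \<in> Hurwitz \<and> q \<noteq> 0 \<and>
                               norm (\<xi> - p \<cdot>\<^sub>H qinv q) < real_ext \<Psi> (norm q)}}"

definition V_set :: "(nat \<Rightarrow> real) \<Rightarrow> quat set"
  where "V_set \<Psi> = W_set \<Psi> \<inter> Delta_bar"

definition full_in :: "quat set \<Rightarrow> quat set \<Rightarrow> bool"
  where "full_in E F \<longleftrightarrow> E \<subseteq> F \<and> F - E \<in> null_sets lebesgue"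

end

(*
  Convergence: at most C m^3 denominators q have [|q|] = m, and a bounded region contains at most
  C m^4 quotients p/q for each of them, so Borel-Cantelli applies to balls of volume Psi(m)^4.

  Divergence: by Dirichlet's theorem for Hurwitz integers, the balls of radius rho_n = 512/N^2,
  N = 128^n, around the fractions with N/128 < |q| <= N fill a fixed proportion of every ball B
  once n is large (denominators below N/128 contribute too little volume). A maximal
  2 rho_n-separated set of these centres carries balls of radius psi_n <= min(Psi(N), rho_n) that
  are disjoint for fixed n and quasi-independent for different n. Condensation turns the
  hypothesis into the divergence of the sum of (psi_n/rho_n)^4, and Bonferroni's inequality over a
  block of levels on which this sum is a small constant shows that, for every T, the balls of
  radius Psi(|q|) around p/q with |q| > T cover a proportion of B that depends neither on B nor
  on T. By a density argument their union has null complement; intersect over T.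
*)
theory Submission
  imports Defs
begin

section \<open>Multiplicativity of the norm and separation of the Hurwitz integers\<close>

lemma norm_qmult: "norm (x \<cdot>\<^sub>H y) = norm x * norm y"
proof -
  have "(norm (x \<cdot>\<^sub>H y))\<^sup>2 = (norm x * norm y)\<^sup>2"
    \<comment> \<open>This is Euler's four-square identity.\<close>
    unfolding power_mult_distrib quat_norm_power2 by (simp add: qmult_def) algebra
  then show ?thesis
    by simp
qed

lemma norm_qcnj: "norm (qcnj x) = norm x"
proof -
  have "(norm (qcnj x))\<^sup>2 = (norm x)\<^sup>2"
    unfolding quat_norm_power2 by (simp add: qcnj_def)
  then show ?thesis
    by simp
qed

lemma norm_qinv: "norm (qinv x) = inverse (norm x)"
  by (cases "x = 0") (simp_all add: qinv_def norm_qcnj power2_eq_square)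

lemma qmult_diff_left: "(x - y) \<cdot>\<^sub>H z = x \<cdot>\<^sub>H z - y \<cdot>\<^sub>H z"
  by (simp add: quat_eq_iff qmult_def algebra_simps)

lemma qmult_diff_right: "x \<cdot>\<^sub>H (y - z) = x \<cdot>\<^sub>H y - x \<cdot>\<^sub>H z"
  by (simp add: quat_eq_iff qmult_def algebra_simps)

text \<open>Right multiplication by \<open>q\<close> clears the denominator, because the fractions
  have the form \<open>p \<cdot>\<^sub>H qinv q\<close>. Approximation by fractions thus becomes a
  question about the linear form \<open>\<xi> \<cdot>\<^sub>H q - p\<close>.\<close>

lemma dist_qdiv:
  assumes "q \<noteq> 0"
  shows "norm (\<xi> - p \<cdot>\<^sub>H qinv q) = norm (\<xi> \<cdot>\<^sub>H q - p) / norm q"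
proof -
  have "\<xi> - p \<cdot>\<^sub>H qinv q = (\<xi> \<cdot>\<^sub>H q - p) \<cdot>\<^sub>H qinv q"
    using assms by (simp add: qmult_diff_left qmult_assoc qmult_qinv qmult_qone)
  then show ?thesis
    by (simp add: norm_qmult norm_qinv divide_inverse)
qed

lemma Hurwitz_diff:
  assumes "x \<in> Hurwitz" "y \<in> Hurwitz"
  shows "x - y \<in> Hurwitz"
proof -
  have aux: "a - b \<in> \<int>" if "a - 1/2 \<in> \<int>" "b - 1/2 \<in> \<int>" for a b :: real
    using Ints_diff[OF that] by simp
  have aux2: "a - b - 1/2 \<in> \<int>" if "a - 1/2 \<in> \<int>" "b \<in> \<int>" for a b :: real
    using Ints_diff[OF that] by (simp add: algebra_simps)
  \<comment> \<open>Here \<open>a - (b - 1/2)\<close> equals \<open>a - b + 1/2\<close>, so a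
    further 1 has to be subtracted.\<close>
  have aux3: "a - b - 1/2 \<in> \<int>" if "a \<in> \<int>" "b - 1/2 \<in> \<int>" for a b :: real
    using Ints_diff[OF Ints_diff[OF that] Ints_1] by (simp add: algebra_simps)
  show ?thesis
    using assms unfolding Hurwitz_def by (auto intro: aux aux2 aux3)
qed

lemma Hurwitz_dist_ge_1:
  assumes "x \<in> Hurwitz" "y \<in> Hurwitz" "x \<noteq> y"
  shows "1 \<le> dist x y"
  using Hurwitz_norm_ge_1[OF Hurwitz_diff[OF assms(1,2)]] assms(3) by (simp add: dist_norm)

section \<open>Counting Hurwitz integers and fractions by volume\<close>

abbreviation ball_vol :: real
  where "ball_vol \<equiv> unit_ball_vol 4"

lemma measure_quat_ball:
  fixes z :: quat
  assumes "0 \<le> r"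
  shows "measure lebesgue (ball z r) = ball_vol * r ^ 4"
  using content_ball[OF assms, of z] by simp

text \<open>Volume comparison: the separation makes the balls of radius \<open>s\<close> pairwise
  disjoint, so their volumes add up to at most that of \<open>U\<close>. Finiteness of
  \<open>S\<close> follows from the same bound, since an infinite \<open>S\<close> would have finite
  subsets of every size.\<close>

lemma packing:
  fixes c :: "'a \<Rightarrow> quat"
  assumes U: "U \<in> lmeasurable" and s: "0 < s"
    and sep: "\<And>x y. x \<in> S \<Longrightarrow> y \<in> S \<Longrightarrow> x \<noteq> y \<Longrightarrow> 2 * s \<le> dist (c x) (c y)"
    and sub: "\<And>x. x \<in> S \<Longrightarrow> ball (c x) s \<subseteq> U"
  shows "finite S" "real (card S) * (ball_vol * s ^ 4) \<le> measure lebesgue U"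
proof -
  have *: "real (card T) * (ball_vol * s ^ 4) \<le> measure lebesgue U" if T: "T \<subseteq> S" "finite T" for T
  proof -
    have "disjoint_family_on (\<lambda>x. ball (c x) s) T"
      unfolding disjoint_family_on_def
    proof (intro ballI impI)
      fix x y assume "x \<in> T" "y \<in> T" "x \<noteq> y"
      then show "ball (c x) s \<inter> ball (c y) s = {}"
        using sep[of x y] T(1) by (intro disjoint_ballI) auto
    qed
    then have "measure lebesgue (\<Union>x\<in>T. ball (c x) s) = (\<Sum>x\<in>T. measure lebesgue (ball (c x) s))"
      using T(2) by (intro measure_UNION') (auto simp: disjoint_family_on_def pairwise_def disjnt_def)
    also have "\<dots> = real (card T) * (ball_vol * s ^ 4)"
      using s by (simp add: measure_quat_ball del: measure_completion)
    finally show ?thesis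
      using measure_mono_fmeasurable[OF _ _ U, of "\<Union>x\<in>T. ball (c x) s"] sub T by fastforce
  qed
  have pos: "0 < ball_vol * s ^ 4"
    using s by (simp add: unit_ball_vol_pos)
  show "finite S"
  proof (rule ccontr)
    assume inf: "infinite S"
    obtain n where n: "measure lebesgue U < real n * (ball_vol * s ^ 4)"
      using reals_Archimedean3[OF pos] by blast
    obtain T where "T \<subseteq> S" "finite T" "card T = n"
      using infinite_arbitrarily_large[OF inf] by blast
    then show False
      using *[of T] n by auto
  qed
  then show "real (card S) * (ball_vol * s ^ 4) \<le> measure lebesgue U"
    using * by blast
qed

text \<open>Balls of radius 1/2 around these points are disjoint and lie in the ball of radius
  \<open>R + 1/2\<close>; the ratio of the volumes is \<open>(2 * R + 1) ^ 4\<close>.\<close>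

lemma Hurwitz_ball:
  fixes z :: quat
  assumes "0 \<le> R"
  shows "finite (Hurwitz \<inter> ball z R)" "real (card (Hurwitz \<inter> ball z R)) \<le> (2 * R + 1) ^ 4"
proof -
  have sub: "ball x (1/2) \<subseteq> ball z (R + 1/2)" if "x \<in> Hurwitz \<inter> ball z R" for x
    using that by (intro subsetI) (simp add: dist_commute, metric)
  note P = packing[of "ball z (R + 1/2)" "1/2" "Hurwitz \<inter> ball z R" "\<lambda>x. x"]
  show "finite (Hurwitz \<inter> ball z R)"
    by (rule P) (use sub Hurwitz_dist_ge_1 in auto)
  have "real (card (Hurwitz \<inter> ball z R)) * (ball_vol * (1/2) ^ 4) \<le> measure lebesgue (ball z (R + 1/2))"
    by (rule P) (use sub Hurwitz_dist_ge_1 in auto)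
  also have "\<dots> = ball_vol * (R + 1/2) ^ 4"
    using assms by (simp add: measure_quat_ball del: measure_completion)
  also have "(R + 1/2) ^ 4 = (2 * R + 1) ^ 4 * (1/2) ^ 4"
    by (simp add: power_mult_distrib[symmetric] field_simps)
  finally have "ball_vol * (1/2)^4 * real (card (Hurwitz \<inter> ball z R)) \<le> ball_vol * (1/2)^4 * (2 * R + 1) ^ 4"
    by (simp add: mult_ac)
  then show "real (card (Hurwitz \<inter> ball z R)) \<le> (2 * R + 1) ^ 4"
    by (simp add: unit_ball_vol_pos)
qed

text \<open>Right multiplication by \<open>q\<close> is a similarity of ratio \<open>norm q\<close>,
  so the fractions with denominator \<open>q\<close> in a ball correspond to the Hurwitz integers in
  a ball of radius \<open>R * norm q\<close>.\<close>

lemma Hurwitz_numerators: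
  assumes "0 \<le> R" "q \<noteq> 0"
  shows "finite {p \<in> Hurwitz. p \<cdot>\<^sub>H qinv q \<in> ball z R}"
    "real (card {p \<in> Hurwitz. p \<cdot>\<^sub>H qinv q \<in> ball z R}) \<le> (2 * R * norm q + 1) ^ 4"
proof -
  have "p \<cdot>\<^sub>H qinv q \<in> ball z R \<longleftrightarrow> p \<in> ball (z \<cdot>\<^sub>H q) (R * norm q)" for p
    using assms by (simp add: dist_norm dist_qdiv divide_less_eq)
  then have "{p \<in> Hurwitz. p \<cdot>\<^sub>H qinv q \<in> ball z R} = Hurwitz \<inter> ball (z \<cdot>\<^sub>H q) (R * norm q)"
    by blast
  then show "finite {p \<in> Hurwitz. p \<cdot>\<^sub>H qinv q \<in> ball z R}"
    "real (card {p \<in> Hurwitz. p \<cdot>\<^sub>H qinv q \<in> ball z R}) \<le> (2 * R * norm q + 1) ^ 4"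
    using Hurwitz_ball[of "R * norm q" "z \<cdot>\<^sub>H q"] assms by (simp_all add: mult.assoc)
qed

text \<open>Balls of radius 1/2 around these points pack the shell \<open>U\<close>, whose constant
  thickness makes its volume of order \<open>m ^ 3\<close>. This exponent and the 4 of
  \<open>Hurwitz_numerators\<close> add up to the 7 of the series.\<close>

lemma Hurwitz_shell:
  assumes "m \<ge> 1"
  shows "real (card {q \<in> Hurwitz. nat \<lfloor>norm q\<rfloor> = m}) \<le> 1000 * real m ^ 3"
proof -
  define U :: "quat set" where "U = ball 0 (real m + 3/2) - ball 0 (real m - 1/2)"
  let ?S = "{q \<in> Hurwitz. nat \<lfloor>norm q\<rfloor> = m}"
  have fl: "real m \<le> norm q \<and> norm q < real m + 1" if "nat \<lfloor>norm q\<rfloor> = m" for q :: quat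
  proof -
    have "\<lfloor>norm q\<rfloor> = int m"
      using that assms by (simp add: nat_eq_iff)
    then show ?thesis
      by (simp add: floor_eq_iff)
  qed
  have sub: "ball x (1/2) \<subseteq> U" if "x \<in> ?S" for x
  proof
    fix y assume "y \<in> ball x (1/2)"
    then have "\<bar>norm x - norm y\<bar> < 1/2"
      using norm_triangle_ineq3[of x y] by (simp add: dist_norm)
    moreover have "real m \<le> norm x" "norm x < real m + 1"
      using fl that by blast+
    ultimately have "real m - 1/2 \<le> norm y" "norm y < real m + 3/2"
      by linarith+
    then show "y \<in> U"
      by (simp add: U_def)
  qed
  have Um: "U \<in> lmeasurable"
    unfolding U_def by (intro fmeasurable_Diff) auto
  have "real (card ?S) * (ball_vol * (1/2) ^ 4) \<le> measure lebesgue U"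
    by (rule packing[OF Um, where c = "\<lambda>x. x"]) (use sub Hurwitz_dist_ge_1 in auto)
  also have "measure lebesgue U = ball_vol * (real m + 3/2) ^ 4 - ball_vol * (real m - 1/2) ^ 4"
    unfolding U_def using assms
    by (subst measurable_measure_Diff)
      (auto simp: measure_quat_ball simp del: measure_completion intro!: subset_ball)
  also have "\<dots> = ball_vol * ((real m + 3/2) ^ 4 - (real m - 1/2) ^ 4)"
    by (simp add: algebra_simps)
  finally have "ball_vol * (real (card ?S) * (1/2) ^ 4)
      \<le> ball_vol * ((real m + 3/2) ^ 4 - (real m - 1/2) ^ 4)"
    by (simp only: mult.left_commute)
  then have "real (card ?S) * (1/2) ^ 4 \<le> (real m + 3/2) ^ 4 - (real m - 1/2) ^ 4"
    by (rule mult_left_le_imp_le) simp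
  moreover have "(real m + 3/2) ^ 4 - (real m - 1/2) ^ 4
      = 8 * real m ^ 3 + 12 * real m ^ 2 + 14 * real m + 5"
    by (simp add: power4_eq_xxxx power3_eq_cube power2_eq_square field_simps)
  \<comment> \<open>Replacing every power by \<open>m ^ 3\<close> leaves the constant 16 * (8 + 12 +
    14 + 5) = 624.\<close>
  moreover have "real m ^ 2 \<le> real m ^ 3" "real m \<le> real m ^ 3" "1 \<le> real m ^ 3"
    using assms power_increasing[of 2 3 "real m"] power_increasing[of 1 3 "real m"]
    by auto
  moreover have "(1/2 :: real) ^ 4 = 1 / 16"
    by (simp add: power4_eq_xxxx)
  ultimately have "real (card ?S) * (1 / 16) \<le> 8 * real m ^ 3 + 12 * real m ^ 2 + 14 * real m + 5"
    "real m ^ 2 \<le> real m ^ 3" "real m \<le> real m ^ 3" "1 \<le> real m ^ 3"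
    by simp_all
  then show ?thesis
    by linarith
qed

section \<open>Dirichlet's theorem for Hurwitz integers\<close>

lemma Hurwitz_of_int: "(\<chi> i. of_int (f i)) \<in> Hurwitz"
  by (simp add: Hurwitz_def)

lemma norm_quat_le:
  fixes x :: quat
  assumes "\<And>i. \<bar>x $ i\<bar> \<le> B"
  shows "norm x \<le> 2 * B"
proof -
  have "0 \<le> B"
    using assms[of 1] by linarith
  have "(x $ i)\<^sup>2 \<le> B\<^sup>2" for i
    using power_mono[OF assms[of i], of 2] by simp
  from this[of 1] this[of 2] this[of 3] this[of 4] have *: "(norm x)\<^sup>2 \<le> (2 * B)\<^sup>2"
    unfolding quat_norm_power2 by simp
  show ?thesis
    using power2_le_imp_le[OF *] \<open>0 \<le> B\<close> by simp
qed

lemma norm_quat_less: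
  fixes x :: quat
  assumes "\<And>i. \<bar>x $ i\<bar> < B"
  shows "norm x < 2 * B"
proof -
  \<comment> \<open>The largest of the four coordinates is attained, which keeps the inequality
    strict.\<close>
  define b where "b = Max (range (\<lambda>i. \<bar>x $ i\<bar>))"
  have "b \<in> range (\<lambda>i. \<bar>x $ i\<bar>)"
    unfolding b_def by (rule Max_in) auto
  then have "b < B"
    using assms by auto
  moreover have "norm x \<le> 2 * b"
    by (rule norm_quat_le) (simp add: b_def)
  ultimately show ?thesis
    by linarith
qed

text \<open>Pigeonhole: the \<open>(N + 1)\<^sup>4\<close> Lipschitz integers \<open>q\<close> with coordinates in \<open>{0..N}\<close>
  send \<open>\<xi> \<cdot>\<^sub>H q\<close> modulo the integers to \<open>N\<^sup>4\<close> boxes of side \<open>1 / N\<close>.\<close>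
lemma quat_Dirichlet:
  fixes \<xi> :: quat and N :: nat
  assumes N: "N \<ge> 1"
  obtains p q where "p \<in> Hurwitz" "q \<in> Hurwitz" "q \<noteq> 0" "norm q \<le> 2 * real N"
    "norm (\<xi> \<cdot>\<^sub>H q - p) < 2 / real N"
proof -
  let ?Q = "{f :: 4 \<Rightarrow> nat. \<forall>i. f i \<in> {..N}}"
  let ?B = "{f :: 4 \<Rightarrow> nat. \<forall>i. f i \<in> {..<N}}"
  have Qe: "?Q = Pi\<^sub>E UNIV (\<lambda>_. {..N})" and Be: "?B = Pi\<^sub>E UNIV (\<lambda>_. {..<N})"
    by (auto simp: PiE_def Pi_def)
  have fin: "finite ?B"
    unfolding Be by (rule finite_PiE) auto
  have cards: "card ?Q = (N + 1) ^ 4" "card ?B = N ^ 4"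
    unfolding Qe Be by (simp_all add: card_PiE)
  define qq :: "(4 \<Rightarrow> nat) \<Rightarrow> quat" where "qq f = (\<chi> i. of_int (int (f i)))" for f
  define bx :: "(4 \<Rightarrow> nat) \<Rightarrow> 4 \<Rightarrow> nat"
    where "bx f i = nat \<lfloor>real N * frac ((\<xi> \<cdot>\<^sub>H qq f) $ i)\<rfloor>" for f i
  have fl: "real (bx f i) \<le> real N * frac ((\<xi> \<cdot>\<^sub>H qq f) $ i)"
    "real N * frac ((\<xi> \<cdot>\<^sub>H qq f) $ i) < real (bx f i) + 1" for f i
  proof -
    have "0 \<le> real N * frac ((\<xi> \<cdot>\<^sub>H qq f) $ i)"
      by simp
    then show "real (bx f i) \<le> real N * frac ((\<xi> \<cdot>\<^sub>H qq f) $ i)"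
      "real N * frac ((\<xi> \<cdot>\<^sub>H qq f) $ i) < real (bx f i) + 1"
      unfolding bx_def by linarith+
  qed
  have "bx f \<in> ?B" for f
  proof -
    have "bx f i < N" for i
    proof -
      have "real N * frac ((\<xi> \<cdot>\<^sub>H qq f) $ i) < real N * 1"
        using N by (intro mult_strict_left_mono) (auto simp: frac_lt_1)
      with fl(1)[of f i] show ?thesis
        by simp
    qed
    then show ?thesis
      by simp
  qed
  then have "card (bx ` ?Q) \<le> card ?B"
    by (intro card_mono fin) auto
  also have "\<dots> < card ?Q"
    unfolding cards by (intro power_strict_mono) auto
  finally obtain f g where fg: "f \<in> ?Q" "g \<in> ?Q" "f \<noteq> g" "bx f = bx g"
    using pigeonhole[of bx ?Q] unfolding inj_on_def by blast
  \<comment> \<open>Subtracting two points of one box leaves coordinates of \<open>q\<close> of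
    absolute value at most \<open>N\<close>. Subtracting the integer parts as \<open>p\<close>
    leaves differences of fractional parts, each below \<open>1 / N\<close>. Passing from
    coordinates to the norm costs the factor 2 in both bounds.\<close>
  define q where "q = qq f - qq g"
  define p :: quat where "p = (\<chi> i. of_int (\<lfloor>(\<xi> \<cdot>\<^sub>H qq f) $ i\<rfloor> - \<lfloor>(\<xi> \<cdot>\<^sub>H qq g) $ i\<rfloor>))"
  show thesis
  proof (rule that)
    show "p \<in> Hurwitz"
      unfolding p_def by (rule Hurwitz_of_int)
    show "q \<in> Hurwitz"
      unfolding q_def qq_def by (intro Hurwitz_diff Hurwitz_of_int)
    show "q \<noteq> 0"
      using fg(3) by (auto simp: q_def qq_def vec_eq_iff)
    have "\<bar>q $ i\<bar> \<le> real N" for i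
    proof -
      have "real (f i) \<le> real N" "real (g i) \<le> real N"
        using fg(1,2) by auto
      then show ?thesis
        by (simp add: q_def qq_def abs_le_iff)
    qed
    then show "norm q \<le> 2 * real N"
      by (rule norm_quat_le)
    have "\<bar>(\<xi> \<cdot>\<^sub>H q - p) $ i\<bar> < 1 / real N" for i
    proof -
      have "(\<xi> \<cdot>\<^sub>H q - p) $ i = frac ((\<xi> \<cdot>\<^sub>H qq f) $ i) - frac ((\<xi> \<cdot>\<^sub>H qq g) $ i)"
        by (simp add: q_def p_def qmult_diff_right frac_def)
      moreover have "\<bar>real N * frac ((\<xi> \<cdot>\<^sub>H qq f) $ i) - real N * frac ((\<xi> \<cdot>\<^sub>H qq g) $ i)\<bar> < 1"
        using fl[of f i] fl[of g i] fg(4) by (simp add: abs_less_iff)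
      ultimately have "\<bar>real N * (\<xi> \<cdot>\<^sub>H q - p) $ i\<bar> < 1"
        by (simp add: right_diff_distrib)
      then have "real N * \<bar>(\<xi> \<cdot>\<^sub>H q - p) $ i\<bar> < 1"
        by (simp only: abs_mult abs_of_nat)
      then show ?thesis
        using N by (simp add: pos_less_divide_eq mult.commute)
    qed
    then show "norm (\<xi> \<cdot>\<^sub>H q - p) < 2 / real N"
      using norm_quat_less by fastforce
  qed
qed

section \<open>The convergence case by Borel-Cantelli\<close>

lemma measure_Union_balls_le:
  fixes c :: "'a \<Rightarrow> quat"
  assumes "finite I" "0 \<le> s" "real (card I) \<le> K"
  shows "measure lebesgue (\<Union>i\<in>I. ball (c i) s) \<le> K * (ball_vol * s ^ 4)"
proof -
  have "measure lebesgue (\<Union>i\<in>I. ball (c i) s) \<le> (\<Sum>i\<in>I. measure lebesgue (ball (c i) s))"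
    using assms(1) by (rule measure_UNION_le) simp
  also have "\<dots> = real (card I) * (ball_vol * s ^ 4)"
    using assms(2) by (simp add: measure_quat_ball del: measure_completion)
  also have "\<dots> \<le> K * (ball_vol * s ^ 4)"
    using assms(3) by (intro mult_right_mono) auto
  finally show ?thesis .
qed

lemma finite_Hurwitz_floor: "finite {q \<in> Hurwitz. nat \<lfloor>norm q\<rfloor> \<le> m}"
proof (rule finite_subset)
  show "{q \<in> Hurwitz. nat \<lfloor>norm q\<rfloor> \<le> m} \<subseteq> Hurwitz \<inter> ball 0 (real m + 1)"
    by (auto simp: nat_le_iff floor_le_iff)
  show "finite (Hurwitz \<inter> ball 0 (real m + 1))"
    by (rule Hurwitz_ball) simp
qed

lemma W_set_null_ball:
  assumes pos: "\<And>m. m \<ge> 1 \<Longrightarrow> \<Psi> m > 0"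
    and sm: "summable (\<lambda>m. \<Psi> (Suc m) ^ 4 * real (Suc m) ^ 7)" and R: "0 \<le> R"
  shows "W_set \<Psi> \<inter> ball 0 R \<in> null_sets lebesgue"
proof -
  obtain K where K: "\<Psi> (Suc m) ^ 4 * real (Suc m) ^ 7 \<le> K" for m
    using summable_imp_Bseq[OF sm] unfolding Bseq_def by (auto simp: abs_le_iff)
  \<comment> \<open>A value of \<open>\<Psi>\<close> above 1 is at most its fourth power, hence at
    most \<open>K\<close>; the added 1 covers the other values. A ball of radius at most
    \<open>C\<close> that meets \<open>ball 0 R\<close> has its centre in
    \<open>ball 0 (R + C)\<close>, so only these centres are counted.\<close>
  define C where "C = K + 1"
  have C: "\<Psi> (Suc m) \<le> C" for m
  proof -
    have "\<Psi> (Suc m) ^ 4 * 1 \<le> \<Psi> (Suc m) ^ 4 * real (Suc m) ^ 7"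
      using pos[of "Suc m"] by (intro mult_left_mono) (auto simp: one_le_power simp del: of_nat_Suc)
    then have "\<Psi> (Suc m) ^ 4 \<le> K"
      using K[of m] by linarith
    moreover have "\<Psi> (Suc m) \<le> 1 \<or> \<Psi> (Suc m) \<le> \<Psi> (Suc m) ^ 4"
      using self_le_power[of "\<Psi> (Suc m)" 4] by linarith
    moreover have "0 \<le> \<Psi> (Suc m) ^ 4"
      by simp
    ultimately show ?thesis
      unfolding C_def by linarith
  qed
  have C0: "0 \<le> C"
    using C[of 0] pos[of "Suc 0"] by simp
  define P where "P q = {p \<in> Hurwitz. p \<cdot>\<^sub>H qinv q \<in> ball 0 (R + C)}" for q
  define Q where "Q m = {q \<in> Hurwitz. nat \<lfloor>norm q\<rfloor> = Suc m}" for m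
  define E where "E m = (\<Union>(q, p)\<in>Sigma (Q m) P. ball (p \<cdot>\<^sub>H qinv q) (\<Psi> (Suc m)))" for m
  \<comment> \<open>From \<open>norm q < Suc m + 1 \<le> 2 * Suc m\<close>, the count
    \<open>(2 * (R + C) * norm q + 1) ^ 4\<close> is at most \<open>(A * Suc m) ^ 4\<close>.\<close>
  define A where "A = 4 * (R + C) + 1"
  have finQ: "finite (Q m)" for m
    by (rule finite_subset[OF _ finite_Hurwitz_floor[of "Suc m"]]) (auto simp: Q_def)
  have Qnz: "q \<noteq> 0" "norm q < real (Suc m) + 1" if "q \<in> Q m" for q m
  proof -
    have "\<lfloor>norm q\<rfloor> = int (Suc m)"
      using that by (simp add: Q_def nat_eq_iff)
    then show "q \<noteq> 0" "norm q < real (Suc m) + 1"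
      by (auto simp: floor_eq_iff)
  qed
  have finP: "finite (P q)" if "q \<noteq> 0" for q
    unfolding P_def using R C0 that by (intro Hurwitz_numerators) auto
  have cardP: "real (card (P q)) \<le> (A * real (Suc m)) ^ 4" if "q \<in> Q m" for q m
  proof -
    have "real (card (P q)) \<le> (2 * (R + C) * norm q + 1) ^ 4"
      unfolding P_def using R C0 Qnz(1)[OF that] by (intro Hurwitz_numerators) auto
    also have "\<dots> \<le> (A * real (Suc m)) ^ 4"
    proof (rule power_mono)
      have "(R + C) * norm q \<le> (R + C) * (2 * real (Suc m))"
        using R C0 Qnz(2)[OF that] by (intro mult_left_mono) auto
      then show "2 * (R + C) * norm q + 1 \<le> A * real (Suc m)"
        unfolding A_def by (simp add: algebra_simps)
      show "0 \<le> 2 * (R + C) * norm q + 1"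
        using R C0 by simp
    qed
    finally show ?thesis .
  qed
  have mE: "measure lebesgue (E m) \<le> 1000 * A ^ 4 * ball_vol * (\<Psi> (Suc m) ^ 4 * real (Suc m) ^ 7)" for m
  proof -
    have "real (card (Sigma (Q m) P)) = (\<Sum>q\<in>Q m. real (card (P q)))"
      using finQ finP Qnz by (subst card_SigmaI) auto
    also have "\<dots> \<le> (\<Sum>q\<in>Q m. (A * real (Suc m)) ^ 4)"
      using cardP by (intro sum_mono) auto
    also have "\<dots> = real (card (Q m)) * (A * real (Suc m)) ^ 4"
      by simp
    also have "\<dots> \<le> (1000 * real (Suc m) ^ 3) * (A * real (Suc m)) ^ 4"
      unfolding Q_def by (intro mult_right_mono Hurwitz_shell) auto
    finally have "real (card (Sigma (Q m) P)) \<le> (1000 * real (Suc m) ^ 3) * (A * real (Suc m)) ^ 4" .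
    then have "measure lebesgue (E m)
        \<le> (1000 * real (Suc m) ^ 3) * (A * real (Suc m)) ^ 4 * (ball_vol * \<Psi> (Suc m) ^ 4)"
      unfolding E_def case_prod_beta using pos[of "Suc m"] finQ finP Qnz
      by (intro measure_Union_balls_le) (auto simp: less_imp_le)
    also have "\<dots> = 1000 * A ^ 4 * ball_vol * (\<Psi> (Suc m) ^ 4 * real (Suc m) ^ 7)"
      by (simp add: power_mult_distrib power_add[of _ 3 4, simplified] del: of_nat_Suc)
    finally show ?thesis .
  qed
  have Esets: "E m \<in> lmeasurable" for m
    unfolding E_def case_prod_beta using finQ finP Qnz
    by (intro fmeasurable.finite_UN) auto
  have "summable (\<lambda>m. measure lebesgue (E m))"
    by (rule summable_comparison_test'[OF summable_mult[OF sm]])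
      (use mE in \<open>auto simp del: measure_completion\<close>)
  then have "limsup E \<in> null_sets lebesgue"
    using Esets by (intro borel_cantelli_limsup1) (auto simp: fmeasurable_def simp del: emeasure_completion)
  moreover have "W_set \<Psi> \<inter> ball 0 R \<subseteq> limsup E"
  proof
    fix \<xi> assume \<xi>: "\<xi> \<in> W_set \<Psi> \<inter> ball 0 R"
    define T where "T = {(p, q). p \<in> Hurwitz \<and> q \<in> Hurwitz \<and> q \<noteq> 0 \<and>
       norm (\<xi> - p \<cdot>\<^sub>H qinv q) < real_ext \<Psi> (norm q)}"
    have T: "infinite T"
      using \<xi> by (simp add: W_set_def T_def)
    have "\<exists>m\<ge>n. \<xi> \<in> E m" for n
    proof (rule ccontr)
      assume no: "\<not> (\<exists>m\<ge>n. \<xi> \<in> E m)"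
      let ?Q = "{q \<in> Hurwitz. nat \<lfloor>norm q\<rfloor> \<le> n} - {0}"
      \<comment> \<open>If no \<open>E m\<close> with \<open>m \<ge> n\<close> contains
        \<open>\<xi>\<close>, the denominators in \<open>T\<close> have integer part at most
        \<open>n\<close>, and each of them admits only the finitely many numerators in
        \<open>P q\<close>; so \<open>T\<close> would be finite.\<close>
      have "T \<subseteq> (\<lambda>(q, p). (p, q)) ` Sigma ?Q P"
      proof safe
        fix p q assume pq: "(p, q) \<in> T"
        then have H: "p \<in> Hurwitz" "q \<in> Hurwitz" "q \<noteq> 0"
          and d: "norm (\<xi> - p \<cdot>\<^sub>H qinv q) < \<Psi> (nat \<lfloor>norm q\<rfloor>)"
          by (auto simp: T_def real_ext_def)
        have "1 \<le> norm q"
          using H by (intro Hurwitz_norm_ge_1)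
        then have "1 \<le> nat \<lfloor>norm q\<rfloor>"
          by (simp add: le_nat_iff le_floor_iff)
        then obtain m where m: "nat \<lfloor>norm q\<rfloor> = Suc m"
          by (metis Suc_le_D One_nat_def)
        have "norm (p \<cdot>\<^sub>H qinv q) \<le> norm \<xi> + norm (\<xi> - p \<cdot>\<^sub>H qinv q)"
          by norm
        also have "\<dots> < R + C"
          using \<xi> d C[of m] m by simp
        finally have p: "p \<in> P q"
          using H by (simp add: P_def)
        have "\<xi> \<in> E m"
          unfolding E_def using p d m H by (auto simp: Q_def dist_norm norm_minus_commute intro!: bexI[of _ "(q, p)"])
        with no have "m < n"
          by (meson not_le)
        with m p H show "(p, q) \<in> (\<lambda>(q, p). (p, q)) ` Sigma ?Q P"
          by (intro image_eqI[of _ _ "(q, p)"]) auto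
      qed
      moreover have "finite (Sigma ?Q P)"
        using finite_Hurwitz_floor finP by (intro finite_SigmaI) auto
      ultimately show False
        using T finite_surj by blast
    qed
    then show "\<xi> \<in> limsup E"
      by (auto simp: limsup_INF_SUP)
  qed
  ultimately show ?thesis
    by (rule null_sets_completion_subset[rotated])
qed

lemma W_set_null:
  assumes "\<And>m. m \<ge> 1 \<Longrightarrow> \<Psi> m > 0"
    and "summable (\<lambda>m. \<Psi> (Suc m) ^ 4 * real (Suc m) ^ 7)"
  shows "W_set \<Psi> \<in> null_sets lebesgue"
proof -
  have "(\<Union>k. W_set \<Psi> \<inter> ball 0 (real k)) \<in> null_sets lebesgue"
    using W_set_null_ball[OF assms] by (intro null_sets_UN) auto
  also have "(\<Union>k. W_set \<Psi> \<inter> ball 0 (real k)) = W_set \<Psi>"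
    using reals_Archimedean2 by auto
  finally show ?thesis .
qed

section \<open>Covering a fixed proportion of a ball by large denominators\<close>

text \<open>When \<open>N / 128 < norm q\<close>, the Dirichlet bound \<open>4 / (N * norm q)\<close> is below \<open>512 / N\<^sup>2\<close>.\<close>
definition good_centres :: "quat \<Rightarrow> real \<Rightarrow> real \<Rightarrow> quat set"
  where "good_centres z r N = {p \<cdot>\<^sub>H qinv q | p q. p \<in> Hurwitz \<and> q \<in> Hurwitz \<and>
    N / 128 < norm q \<and> norm q \<le> N \<and> p \<cdot>\<^sub>H qinv q \<in> ball z (3 / 4 * r)}"

text \<open>Dirichlet's theorem with parameter \<open>M\<close> gives \<open>norm q \<le> N\<close>
  and an error below \<open>4 / (N * norm q)\<close>. A large denominator leads to the first
  alternative, where one radius serves all fractions; a small one leads to the exceptional set of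
  the second. The lower bound on \<open>N\<close> brings the error below \<open>r / 4\<close>, which
  keeps the fraction within \<open>3 / 4 * r\<close> of \<open>z\<close>.\<close>

lemma good_centres_cover:
  fixes z :: quat and r :: real and M :: nat
  defines "N \<equiv> 2 * real M"
  assumes r: "0 < r" "r \<le> 1" and N: "128 / r\<^sup>2 \<le> N"
    and \<xi>: "\<xi> \<in> ball z (r / 2)"
  shows "(\<exists>x\<in>good_centres z r N. \<xi> \<in> ball x (512 / N\<^sup>2)) \<or>
    (\<exists>p q. p \<in> Hurwitz \<and> q \<in> Hurwitz \<and> q \<noteq> 0 \<and> norm q \<le> N / 128 \<and>
       p \<cdot>\<^sub>H qinv q \<in> ball z r \<and> \<xi> \<in> ball (p \<cdot>\<^sub>H qinv q) (4 / (N * norm q)))"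
proof -
  have "r\<^sup>2 \<le> r" "r\<^sup>2 \<le> 1" "0 < r\<^sup>2"
    using r by (auto simp: power2_eq_square mult_le_one)
  then have "128 \<le> 128 / r\<^sup>2" "128 / r \<le> 128 / r\<^sup>2"
    using divide_left_mono[of "r\<^sup>2" 1 128] divide_left_mono[of "r\<^sup>2" r 128] r by auto
  then have N0: "128 \<le> N" "128 / r \<le> N"
    using N by linarith+
  then have "M \<ge> 1"
    unfolding N_def by linarith
  then obtain p q where pq: "p \<in> Hurwitz" "q \<in> Hurwitz" "q \<noteq> 0" "norm q \<le> 2 * real M"
    "norm (\<xi> \<cdot>\<^sub>H q - p) < 2 / real M"
    by (rule quat_Dirichlet)
  then have pq5: "norm (\<xi> \<cdot>\<^sub>H q - p) < 4 / N"
    by (simp add: N_def)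
  have q1: "1 \<le> norm q"
    using pq by (intro Hurwitz_norm_ge_1)
  have "norm (\<xi> \<cdot>\<^sub>H q - p) / norm q < 4 / N / norm q"
    using pq5 q1 by (intro divide_strict_right_mono) auto
  then have d: "norm (\<xi> - p \<cdot>\<^sub>H qinv q) < 4 / (N * norm q)"
    using pq(3) by (simp add: dist_qdiv)
  have "4 / (N * norm q) \<le> 4 / (128 / r * 1)"
    using N0 r q1 by (intro divide_left_mono mult_mono mult_pos_pos) auto
  also have "\<dots> < r / 4"
    using r by simp
  finally have "norm (\<xi> - p \<cdot>\<^sub>H qinv q) < r / 4"
    using d by linarith
  then have c: "p \<cdot>\<^sub>H qinv q \<in> ball z (3 / 4 * r)"
    using \<xi> norm_triangle_ineq[of "z - \<xi>" "\<xi> - p \<cdot>\<^sub>H qinv q"] by (simp add: dist_norm)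
  show ?thesis
  proof (cases "N / 128 < norm q")
    case True
    have "N * (N / 128) \<le> N * norm q"
      using True N0 by (intro mult_left_mono) auto
    then have "4 / (N * norm q) \<le> 4 / (N * (N / 128))"
      using N0 q1 by (intro divide_left_mono mult_pos_pos) auto
    also have "\<dots> = 512 / N\<^sup>2"
      by (simp add: power2_eq_square)
    finally have "\<xi> \<in> ball (p \<cdot>\<^sub>H qinv q) (512 / N\<^sup>2)"
      using d by (simp add: dist_norm norm_minus_commute)
    moreover have "p \<cdot>\<^sub>H qinv q \<in> good_centres z r N"
      using pq c True unfolding good_centres_def N_def by blast
    ultimately show ?thesis
      by blast
  next
    case False
    moreover have "p \<cdot>\<^sub>H qinv q \<in> ball z r"
      using c r by simp
    moreover have "\<xi> \<in> ball (p \<cdot>\<^sub>H qinv q) (4 / (N * norm q))"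
      using d by (simp add: dist_norm norm_minus_commute)
    ultimately show ?thesis
      using pq by (meson not_less)
  qed
qed

text \<open>Up to a constant over \<open>N ^ 4\<close>, the summand bounds the volume of the
  exceptional balls with denominator \<open>q\<close>. It is at most \<open>(3 * r) ^ 4\<close> once
  \<open>norm q \<ge> 1 / r\<close>; each of the at most \<open>81 / r ^ 4\<close> smaller
  denominators contributes no more than 81.\<close>

lemma small_denominator_sum:
  fixes z :: quat and r T :: real
  assumes r: "0 < r" "r \<le> 1" and T: "1 \<le> T"
  defines "Q \<equiv> {q \<in> Hurwitz. q \<noteq> 0 \<and> norm q \<le> T}"
  shows "finite Q" "(\<Sum>q\<in>Q. (2 * r + 1 / norm q) ^ 4) \<le> 81 * r ^ 4 * (256 * T ^ 4) + 81 * (81 / r ^ 4)"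
proof -
  have sub: "Q \<subseteq> Hurwitz \<inter> ball 0 (T + 1/2)"
    by (auto simp: Q_def)
  have H: "finite (Hurwitz \<inter> ball (0::quat) (T + 1/2))"
    "real (card (Hurwitz \<inter> ball (0::quat) (T + 1/2))) \<le> (2 * (T + 1/2) + 1) ^ 4"
    using Hurwitz_ball[of "T + 1/2" 0] T by auto
  show fin: "finite Q"
    using sub H(1) by (rule finite_subset)
  have "real (card Q) \<le> real (card (Hurwitz \<inter> ball (0::quat) (T + 1/2)))"
    using card_mono[OF H(1) sub] by simp
  also have "\<dots> \<le> (2 * (T + 1/2) + 1) ^ 4"
    by (rule H)
  also have "\<dots> \<le> (4 * T) ^ 4"
    using T by (intro power_mono) auto
  finally have cQ: "real (card Q) \<le> 256 * T ^ 4"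
    by (simp add: power_mult_distrib)
  define Q1 where "Q1 = {q \<in> Q. norm q < 1 / r}"
  have sub1: "Q1 \<subseteq> Hurwitz \<inter> ball 0 (1 / r)"
    by (auto simp: Q1_def Q_def)
  have H1: "finite (Hurwitz \<inter> ball (0::quat) (1 / r))"
    "real (card (Hurwitz \<inter> ball (0::quat) (1 / r))) \<le> (2 * (1 / r) + 1) ^ 4"
    using Hurwitz_ball[of "1 / r" 0] r by auto
  have "real (card Q1) \<le> real (card (Hurwitz \<inter> ball (0::quat) (1 / r)))"
    using card_mono[OF H1(1) sub1] by simp
  also have "\<dots> \<le> (2 * (1 / r) + 1) ^ 4"
    by (rule H1)
  also have "\<dots> \<le> (3 / r) ^ 4"
    using r by (intro power_mono) (auto simp: field_simps)
  finally have cQ1: "real (card Q1) \<le> 81 / r ^ 4"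
    by (simp add: power_divide)
  have le: "(2 * r + 1 / norm q) ^ 4 \<le> 81 * r ^ 4 + (if q \<in> Q1 then 81 else 0)" if q: "q \<in> Q" for q
  proof -
    have q1: "1 \<le> norm q"
      using q by (intro Hurwitz_norm_ge_1) (auto simp: Q_def)
    show ?thesis
    proof (cases "q \<in> Q1")
      case True
      have "1 / norm q \<le> 1"
        using q1 by (subst divide_le_eq_1_pos) auto
      then have "(2 * r + 1 / norm q) ^ 4 \<le> 81"
        using power_mono[of "2 * r + 1 / norm q" 3 4] r by simp
      moreover have "0 \<le> 81 * r ^ 4"
        by simp
      ultimately show ?thesis
        unfolding if_P[OF True] by linarith
    next
      case False
      then have "1 / r \<le> norm q"
        using q by (auto simp: Q1_def)
      then have "1 / norm q \<le> r"
        using r q1 by (auto simp: divide_le_eq mult.commute)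
      then have "(2 * r + 1 / norm q) ^ 4 \<le> (3 * r) ^ 4"
        using r by (intro power_mono) auto
      then show ?thesis
        using False by (simp add: power_mult_distrib)
    qed
  qed
  have "(\<Sum>q\<in>Q. (2 * r + 1 / norm q) ^ 4) \<le> (\<Sum>q\<in>Q. 81 * r ^ 4 + (if q \<in> Q1 then 81 else 0))"
    by (rule sum_mono) (rule le)
  also have "\<dots> = 81 * r ^ 4 * real (card Q) + 81 * real (card Q1)"
    using fin by (simp add: sum.distrib sum.If_cases Q1_def Collect_conj_eq Int_commute inf.absorb2)
  also have "\<dots> \<le> 81 * r ^ 4 * (256 * T ^ 4) + 81 * (81 / r ^ 4)"
    using cQ cQ1 by (intro add_mono mult_left_mono) auto
  finally show "(\<Sum>q\<in>Q. (2 * r + 1 / norm q) ^ 4) \<le> 81 * r ^ 4 * (256 * T ^ 4) + 81 * (81 / r ^ 4)" .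
qed

text \<open>The ball of radius \<open>r / 2\<close> has volume \<open>ball_vol * r ^ 4 / 16\<close>.
  The window ratio 128 is large enough for the exceptional balls of small denominators to use up at
  most half of it.\<close>

lemma good_centres_measure:
  fixes z :: quat and r :: real and M :: nat
  defines "N \<equiv> 2 * real M"
  assumes r: "0 < r" "r \<le> 1" and N: "128 / r\<^sup>2 \<le> N"
  shows "ball_vol * r ^ 4 / 32
    \<le> measure lebesgue (ball z (r / 2) \<inter> (\<Union>x\<in>good_centres z r N. ball x (512 / N\<^sup>2)))"
proof -
  define T where "T = N / 128"
  define Q where "Q = {q \<in> Hurwitz. q \<noteq> 0 \<and> norm q \<le> T}"
  define P where "P q = {p \<in> Hurwitz. p \<cdot>\<^sub>H qinv q \<in> ball z r}" for q
  define Bad where "Bad = (\<Union>q\<in>Q. \<Union>p\<in>P q. ball (p \<cdot>\<^sub>H qinv q) (4 / (N * norm q)))"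
  define Good where "Good = ball z (r / 2) \<inter> (\<Union>x\<in>good_centres z r N. ball x (512 / N\<^sup>2))"
  have r2: "0 < r\<^sup>2" "r\<^sup>2 \<le> 1"
    using r by (auto simp: power_le_one)
  have T1: "1 / r\<^sup>2 \<le> T" "1 \<le> 1 / r\<^sup>2"
    using N r2 by (auto simp: T_def)
  then have T: "1 \<le> T" and N0: "0 < N"
    by (auto simp: T_def)
  note sds = small_denominator_sum[OF r T, folded Q_def]
  have finP: "finite (P q)" "real (card (P q)) \<le> (2 * r * norm q + 1) ^ 4" if "q \<in> Q" for q
    unfolding P_def using r that by (intro Hurwitz_numerators; auto simp: Q_def)+
  have "measure lebesgue Bad \<le> (\<Sum>q\<in>Q. measure lebesgue (\<Union>p\<in>P q. ball (p \<cdot>\<^sub>H qinv q) (4 / (N * norm q))))"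
    unfolding Bad_def using finP sds(1) by (intro measure_UNION_le sets.finite_UN) auto
  also have "\<dots> \<le> (\<Sum>q\<in>Q. 256 * ball_vol / N ^ 4 * (2 * r + 1 / norm q) ^ 4)"
  proof (rule sum_mono)
    fix q assume q: "q \<in> Q"
    have nz: "norm q \<noteq> 0"
      using q by (simp add: Q_def)
    have "measure lebesgue (\<Union>p\<in>P q. ball (p \<cdot>\<^sub>H qinv q) (4 / (N * norm q)))
        \<le> (2 * r * norm q + 1) ^ 4 * (ball_vol * (4 / (N * norm q)) ^ 4)"
      using finP[OF q] N0 by (intro measure_Union_balls_le) auto
    also have "\<dots> = 256 * ball_vol / N ^ 4 * ((2 * r * norm q + 1) / norm q) ^ 4"
      by (simp add: power_divide power_mult_distrib)
    also have "(2 * r * norm q + 1) / norm q = 2 * r + 1 / norm q"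
      using nz by (simp add: field_simps)
    finally show "measure lebesgue (\<Union>p\<in>P q. ball (p \<cdot>\<^sub>H qinv q) (4 / (N * norm q)))
        \<le> 256 * ball_vol / N ^ 4 * (2 * r + 1 / norm q) ^ 4" .
  qed
  also have "\<dots> = 256 * ball_vol / N ^ 4 * (\<Sum>q\<in>Q. (2 * r + 1 / norm q) ^ 4)"
    by (simp add: sum_distrib_left)
  also have "\<dots> \<le> 256 * ball_vol / N ^ 4 * (81 * r ^ 4 * (256 * T ^ 4) + 81 * (81 / r ^ 4))"
    by (intro mult_left_mono sds(2)) auto
  \<comment> \<open>With \<open>T = N / 128\<close> the first coefficient is 256 * 81 * 256 / 128^4
    = 81 / 4096; the second is 256 * 81 * 81 = 1679616.\<close>
  also have "\<dots> = ball_vol * (81 / 4096 * r ^ 4 + 1679616 / (N ^ 4 * r ^ 4))"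
    using N0 r by (simp add: T_def power_divide field_simps)
  also have "\<dots> \<le> ball_vol * (81 / 4096 * r ^ 4 + 1679616 / 128 ^ 4 * r ^ 4)"
  proof (intro mult_left_mono add_left_mono)
    have "128 ^ 4 \<le> (N * r\<^sup>2) ^ 4"
      using N r2 by (intro power_mono) (auto simp: field_simps)
    then have "128 ^ 4 \<le> N ^ 4 * r ^ 4 * r ^ 4"
      by (simp add: power_mult_distrib mult.assoc flip: power_mult power_add)
    then show "1679616 / (N ^ 4 * r ^ 4) \<le> 1679616 / 128 ^ 4 * r ^ 4"
      using N0 r by (simp add: field_simps)
  qed auto
  \<comment> \<open>The coefficients are below 0.0198 and 0.0063, and 1 / 32 is 0.03125.\<close>
  also have "\<dots> \<le> ball_vol * (r ^ 4 / 32)"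
    using r by (intro mult_left_mono) auto
  finally have bad: "measure lebesgue Bad \<le> ball_vol * (r ^ 4 / 32)" .
  have "ball z (r / 2) \<subseteq> Good \<union> Bad"
  proof
    fix \<xi> assume \<xi>: "\<xi> \<in> ball z (r / 2)"
    from good_centres_cover[OF r N[unfolded N_def] this, folded N_def]
    show "\<xi> \<in> Good \<union> Bad"
    proof (elim disjE exE conjE)
      assume "\<exists>x\<in>good_centres z r N. \<xi> \<in> ball x (512 / N\<^sup>2)"
      with \<xi> show ?thesis
        unfolding Good_def by blast
    next
      fix p q
      assume "p \<in> Hurwitz" "q \<in> Hurwitz" "q \<noteq> 0" "norm q \<le> N / 128"
        "p \<cdot>\<^sub>H qinv q \<in> ball z r" and b: "\<xi> \<in> ball (p \<cdot>\<^sub>H qinv q) (4 / (N * norm q))"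
      then have "q \<in> Q" "p \<in> P q"
        by (auto simp: Q_def P_def T_def)
      with b show ?thesis
        unfolding Bad_def by blast
    qed
  qed
  moreover have GS: "Good \<in> lmeasurable"
    unfolding Good_def by (intro lmeasurable_open) (auto intro: bounded_Int)
  moreover have BS: "Bad \<in> lmeasurable"
    unfolding Bad_def using finP sds(1) by (intro fmeasurable.finite_UN) auto
  ultimately have "measure lebesgue (ball z (r / 2)) \<le> measure lebesgue (Good \<union> Bad)"
    by (intro measure_mono_fmeasurable fmeasurable.Un) auto
  also have "\<dots> \<le> measure lebesgue Good + measure lebesgue Bad"
    using GS BS by (intro measure_Un_le) auto
  finally have "measure lebesgue (ball z (r / 2)) \<le> measure lebesgue Good + ball_vol * (r ^ 4 / 32)"
    using bad by linarith
  moreover have "measure lebesgue (ball z (r / 2)) = ball_vol * r ^ 4 / 16"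
    using r by (simp add: measure_quat_ball power_divide del: measure_completion)
  ultimately show ?thesis
    unfolding Good_def[symmetric] by simp
qed

section \<open>Separated layers of balls and their overlaps\<close>

text \<open>A \<open>2 * \<rho>\<close>-separated subset of largest cardinality works. Packing
  bounds the cardinalities, and a point at distance at least \<open>2 * \<rho>\<close> from the
  whole subset could be added to it.\<close>

lemma separated_net:
  fixes X :: "quat set"
  assumes X: "X \<subseteq> ball z R" and \<rho>: "0 < \<rho>"
  obtains G where "finite G" "G \<subseteq> X"
    "\<And>x y. x \<in> G \<Longrightarrow> y \<in> G \<Longrightarrow> x \<noteq> y \<Longrightarrow> 2 * \<rho> \<le> dist x y"
    "\<And>x. x \<in> X \<Longrightarrow> \<exists>g\<in>G. dist x g < 2 * \<rho>"
proof -
  define sep where "sep G \<longleftrightarrow> G \<subseteq> X \<and> (\<forall>x\<in>G. \<forall>y\<in>G. x \<noteq> y \<longrightarrow> 2 * \<rho> \<le> dist x y)" for G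
  have v: "0 < ball_vol * \<rho> ^ 4"
    using \<rho> by simp
  have sep: "finite G" "real (card G) * (ball_vol * \<rho> ^ 4) \<le> measure lebesgue (ball z (R + \<rho>))"
    if "sep G" for G
  proof -
    have sub: "ball x \<rho> \<subseteq> ball z (R + \<rho>)" if "x \<in> G" for x
    proof -
      have "dist z x < R"
        using \<open>sep G\<close> that X by (auto simp: sep_def)
      then show ?thesis
        by (intro subsetI) (simp, metric)
    qed
    note P = packing[of "ball z (R + \<rho>)" \<rho> G "\<lambda>x. x"]
    show "finite G"
      by (rule P) (use \<open>sep G\<close> sub \<rho> in \<open>auto simp: sep_def\<close>)
    show "real (card G) * (ball_vol * \<rho> ^ 4) \<le> measure lebesgue (ball z (R + \<rho>))"
      by (rule P) (use \<open>sep G\<close> sub \<rho> in \<open>auto simp: sep_def\<close>)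
  qed
  obtain K where K: "measure lebesgue (ball z (R + \<rho>)) < real K * (ball_vol * \<rho> ^ 4)"
    using reals_Archimedean3[OF v] by blast
  have "card G < K" if "sep G" for G
  proof -
    have "real (card G) * (ball_vol * \<rho> ^ 4) < real K * (ball_vol * \<rho> ^ 4)"
      using sep(2)[OF that] K by linarith
    then show ?thesis
      using v by (simp only: mult_less_cancel_right_pos of_nat_less_iff)
  qed
  moreover have "sep {}"
    by (simp add: sep_def)
  ultimately obtain G where G: "sep G" and max: "\<And>G'. sep G' \<Longrightarrow> card G' \<le> card G"
    using ex_has_greatest_nat[of sep "{}" card K] by blast
  show thesis
  proof
    show "finite G"
      using sep(1)[OF G] .
    show "G \<subseteq> X" and "\<And>x y. x \<in> G \<Longrightarrow> y \<in> G \<Longrightarrow> x \<noteq> y \<Longrightarrow> 2 * \<rho> \<le> dist x y"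
      using G by (auto simp: sep_def)
    show "\<exists>g\<in>G. dist x g < 2 * \<rho>" if x: "x \<in> X" for x
    proof (rule ccontr)
      assume no: "\<not> (\<exists>g\<in>G. dist x g < 2 * \<rho>)"
      then have "x \<notin> G"
        using \<rho> by force
      moreover have "sep (insert x G)"
        using no G x unfolding sep_def by (auto simp: not_less dist_commute)
      ultimately show False
        using max[of "insert x G"] sep(1)[OF G] by simp
    qed
  qed
qed

text \<open>Balls of radius \<open>3 * \<rho>\<close> around a net still cover what the balls of
  radius \<open>\<rho>\<close> around all good centres cover, so thinning costs a factor
  \<open>3 ^ 4\<close>: 2592 = 32 * 81. The upper bound on the cardinality is packing in
  \<open>ball z r\<close>.\<close>

lemma separated_layer:
  fixes z :: quat and r :: real and M :: nat
  defines "N \<equiv> 2 * real M"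
  defines "\<rho> \<equiv> 512 / N\<^sup>2"
  assumes r: "0 < r" "r \<le> 1" and N: "128 / r\<^sup>2 \<le> N"
  obtains G where "finite G" "G \<subseteq> good_centres z r N"
    "\<And>x y. x \<in> G \<Longrightarrow> y \<in> G \<Longrightarrow> x \<noteq> y \<Longrightarrow> 2 * \<rho> \<le> dist x y"
    "r ^ 4 / 2592 \<le> real (card G) * \<rho> ^ 4" "real (card G) * \<rho> ^ 4 \<le> r ^ 4" "\<rho> \<le> r / 4"
proof -
  have r2: "0 < r\<^sup>2"
    using r by simp
  have N0: "0 < N"
    using N divide_pos_pos[OF _ r2, of 128] by linarith
  have \<rho>0: "0 < \<rho>"
    using N0 by (simp add: \<rho>_def)
  have "128 * 128 \<le> (N * r\<^sup>2) * (N * r\<^sup>2)"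
    using N r2 by (intro mult_mono) (auto simp: divide_le_eq)
  then have "512 / N\<^sup>2 \<le> r ^ 4 / 32"
    using N0 by (simp add: field_simps power2_eq_square power4_eq_xxxx)
  moreover have "r ^ 4 \<le> r ^ 1"
    using r by (intro power_decreasing) auto
  ultimately have \<rho>r: "\<rho> \<le> r / 4"
    unfolding \<rho>_def using r by simp
  have sub: "good_centres z r N \<subseteq> ball z (3 / 4 * r)"
    by (auto simp: good_centres_def)
  obtain G where G: "finite G" "G \<subseteq> good_centres z r N"
    "\<And>x y. x \<in> G \<Longrightarrow> y \<in> G \<Longrightarrow> x \<noteq> y \<Longrightarrow> 2 * \<rho> \<le> dist x y"
    "\<And>x. x \<in> good_centres z r N \<Longrightarrow> \<exists>g\<in>G. dist x g < 2 * \<rho>"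
    using separated_net[OF sub \<rho>0] by metis
  have "ball z (r / 2) \<inter> (\<Union>x\<in>good_centres z r N. ball x \<rho>) \<subseteq> (\<Union>g\<in>G. ball g (3 * \<rho>))"
  proof
    fix y assume "y \<in> ball z (r / 2) \<inter> (\<Union>x\<in>good_centres z r N. ball x \<rho>)"
    then obtain x where x: "x \<in> good_centres z r N" "dist x y < \<rho>"
      by auto
    then obtain g where "g \<in> G" "dist x g < 2 * \<rho>"
      using G(4) by blast
    then have "dist g y < 3 * \<rho>"
      using x(2) by metric
    then show "y \<in> (\<Union>g\<in>G. ball g (3 * \<rho>))"
      using \<open>g \<in> G\<close> by auto
  qed
  then have "measure lebesgue (ball z (r / 2) \<inter> (\<Union>x\<in>good_centres z r N. ball x \<rho>))
      \<le> measure lebesgue (\<Union>g\<in>G. ball g (3 * \<rho>))"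
    using G(1) by (intro measure_mono_fmeasurable fmeasurable.finite_UN)
      (auto intro!: fmeasurableD lmeasurable_open bounded_Int open_Int open_UN)
  also have "\<dots> \<le> real (card G) * (ball_vol * (3 * \<rho>) ^ 4)"
    using G(1) \<rho>0 by (intro measure_Union_balls_le) auto
  finally have "ball_vol * r ^ 4 / 32 \<le> real (card G) * (ball_vol * (3 * \<rho>) ^ 4)"
    using good_centres_measure[OF r N[unfolded N_def], of z, folded N_def, folded \<rho>_def] by linarith
  then have "ball_vol * (r ^ 4 / 2592) \<le> ball_vol * (real (card G) * \<rho> ^ 4)"
    by (simp add: power_mult_distrib mult_ac)
  then have lo: "r ^ 4 / 2592 \<le> real (card G) * \<rho> ^ 4"
    by (rule mult_left_le_imp_le) simp
  have "ball g \<rho> \<subseteq> ball z r" if "g \<in> G" for g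
  proof -
    have "dist z g < 3 / 4 * r"
      using that G(2) sub by auto
    then show ?thesis
      using \<rho>r by (intro subsetI) (simp, metric)
  qed
  then have "real (card G) * (ball_vol * \<rho> ^ 4) \<le> measure lebesgue (ball z r)"
    using G(3) by (intro packing[of _ _ _ "\<lambda>x. x"] \<rho>0) auto
  also have "\<dots> = ball_vol * r ^ 4"
    using r by (simp add: measure_quat_ball del: measure_completion)
  finally have "ball_vol * (real (card G) * \<rho> ^ 4) \<le> ball_vol * r ^ 4"
    by (simp add: mult_ac)
  then have "real (card G) * \<rho> ^ 4 \<le> r ^ 4"
    by (rule mult_left_le_imp_le) simp
  with that G(1-3) lo \<rho>r show thesis
    by blast
qed

lemma separated_layer_measure:
  fixes G :: "quat set"
  assumes "finite G" "\<And>x y. x \<in> G \<Longrightarrow> y \<in> G \<Longrightarrow> x \<noteq> y \<Longrightarrow> 2 * \<rho> \<le> dist x y" "0 \<le> \<psi>" "\<psi> \<le> \<rho>"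
  shows "measure lebesgue (\<Union>g\<in>G. ball g \<psi>) = real (card G) * (ball_vol * \<psi> ^ 4)"
proof -
  have "measure lebesgue (\<Union>g\<in>G. ball g \<psi>) = (\<Sum>g\<in>G. measure lebesgue (ball g \<psi>))"
  proof (rule measure_UNION'[OF assms(1)])
    show "pairwise (\<lambda>i j. disjnt (ball i \<psi>) (ball j \<psi>)) G"
    proof (rule pairwiseI)
      fix i j assume "i \<in> G" "j \<in> G" "i \<noteq> j"
      then have "\<psi> + \<psi> \<le> dist i j"
        using assms(2)[of i j] assms(4) by linarith
      then show "disjnt (ball i \<psi>) (ball j \<psi>)"
        unfolding disjnt_def by (rule disjoint_ballI)
    qed
  qed simp
  then show ?thesis
    using assms(3) by (simp add: measure_quat_ball del: measure_completion)
qed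

lemma power4_sum_le:
  fixes x y :: real
  shows "(x + y) ^ 4 \<le> 8 * (x ^ 4 + y ^ 4)"
proof -
  have sq: "(a + b)\<^sup>2 \<le> 2 * (a\<^sup>2 + b\<^sup>2)" for a b :: real
    using sum_squares_bound[of a b] by (simp add: power2_sum)
  have "(x + y) ^ 4 = ((x + y)\<^sup>2)\<^sup>2"
    by (simp flip: power_mult)
  also have "\<dots> \<le> (2 * (x\<^sup>2 + y\<^sup>2))\<^sup>2"
    using sq[of x y] by (intro power_mono) auto
  also have "\<dots> = 4 * (x\<^sup>2 + y\<^sup>2)\<^sup>2"
    unfolding power_mult_distrib by simp
  also have "\<dots> \<le> 4 * (2 * ((x\<^sup>2)\<^sup>2 + (y\<^sup>2)\<^sup>2))"
    by (intro mult_left_mono sq) auto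
  finally show ?thesis
    by (simp flip: power_mult)
qed

text \<open>If \<open>ball h \<psi>'\<close> meets \<open>ball g \<psi>\<close>, then
  \<open>ball h \<rho>'\<close> lies in \<open>ball g (\<psi> + 2 * \<rho>')\<close>, so packing
  bounds the number of such \<open>h\<close> for each \<open>g\<close>. The first term is the
  product expected of independent sets; the second arises because a small ball around
  \<open>g\<close> may still meet a few balls of the other layer, and it is harmless when
  \<open>\<rho>'\<close> is much smaller than \<open>\<rho>\<close>.\<close>

lemma separated_layers_overlap:
  fixes G G' :: "quat set"
  assumes G: "finite G" "real (card G) * \<rho> ^ 4 \<le> R" "0 < \<rho>" "0 \<le> \<psi>"
    and G': "finite G'" "\<And>x y. x \<in> G' \<Longrightarrow> y \<in> G' \<Longrightarrow> x \<noteq> y \<Longrightarrow> 2 * \<rho>' \<le> dist x y"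
    and \<rho>': "0 < \<rho>'" "0 \<le> \<psi>'" "\<psi>' \<le> \<rho>'"
  shows "measure lebesgue ((\<Union>g\<in>G. ball g \<psi>) \<inter> (\<Union>h\<in>G'. ball h \<psi>'))
    \<le> 8 * ball_vol * R * ((\<psi> / \<rho>) ^ 4 * (\<psi>' / \<rho>') ^ 4 + 16 * (\<rho>' / \<rho>) ^ 4 * (\<psi>' / \<rho>') ^ 4)"
proof -
  define H where "H g = {h \<in> G'. dist g h < \<psi> + \<psi>'}" for g
  define C where "C = 8 * (\<psi> ^ 4 + 16 * \<rho>' ^ 4) / \<rho>' ^ 4"
  have cardH: "real (card (H g)) \<le> C" for g
  proof -
    have "ball h \<rho>' \<subseteq> ball g (\<psi> + 2 * \<rho>')" if "h \<in> H g" for h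
    proof -
      have "dist g h < \<psi> + \<psi>'"
        using that by (simp add: H_def)
      then show ?thesis
        using \<rho>'(3) by (intro subsetI) (simp, metric)
    qed
    then have "real (card (H g)) * (ball_vol * \<rho>' ^ 4) \<le> measure lebesgue (ball g (\<psi> + 2 * \<rho>'))"
      using G'(2) by (intro packing[of _ _ _ "\<lambda>x. x"] \<rho>') (auto simp: H_def)
    also have "\<dots> = ball_vol * (\<psi> + 2 * \<rho>') ^ 4"
      using G \<rho>' by (simp add: measure_quat_ball del: measure_completion)
    finally have "ball_vol * (real (card (H g)) * \<rho>' ^ 4) \<le> ball_vol * (\<psi> + 2 * \<rho>') ^ 4"
      by (simp add: mult_ac)
    then have "real (card (H g)) * \<rho>' ^ 4 \<le> (\<psi> + 2 * \<rho>') ^ 4"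
      by (rule mult_left_le_imp_le) simp
    also have "\<dots> \<le> 8 * (\<psi> ^ 4 + (2 * \<rho>') ^ 4)"
      by (rule power4_sum_le)
    finally show ?thesis
      using \<rho>' by (simp add: C_def le_divide_eq power_mult_distrib)
  qed
  have "(\<Union>g\<in>G. ball g \<psi>) \<inter> (\<Union>h\<in>G'. ball h \<psi>') \<subseteq> (\<Union>g\<in>G. \<Union>h\<in>H g. ball h \<psi>')"
  proof
    fix y assume "y \<in> (\<Union>g\<in>G. ball g \<psi>) \<inter> (\<Union>h\<in>G'. ball h \<psi>')"
    then obtain g h where gh: "g \<in> G" "h \<in> G'" "dist g y < \<psi>" "dist h y < \<psi>'"
      by auto
    then have "dist g h < \<psi> + \<psi>'"
      by metric
    then show "y \<in> (\<Union>g\<in>G. \<Union>h\<in>H g. ball h \<psi>')"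
      using gh by (auto simp: H_def)
  qed
  moreover have finH: "finite (H g)" for g
    using G'(1) by (simp add: H_def)
  ultimately have "measure lebesgue ((\<Union>g\<in>G. ball g \<psi>) \<inter> (\<Union>h\<in>G'. ball h \<psi>'))
      \<le> measure lebesgue (\<Union>g\<in>G. \<Union>h\<in>H g. ball h \<psi>')"
    using G(1) G'(1) by (intro measure_mono_fmeasurable fmeasurable.finite_UN sets.Int sets.finite_UN) auto
  also have "\<dots> \<le> (\<Sum>g\<in>G. measure lebesgue (\<Union>h\<in>H g. ball h \<psi>'))"
    using G(1) finH by (intro measure_UNION_le sets.finite_UN) auto
  also have "\<dots> \<le> (\<Sum>g\<in>G. C * (ball_vol * \<psi>' ^ 4))"
    using finH \<rho>' cardH by (intro sum_mono measure_Union_balls_le) auto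
  also have "\<dots> = real (card G) * (C * (ball_vol * \<psi>' ^ 4))"
    by simp
  also have "\<dots> \<le> R / \<rho> ^ 4 * (C * (ball_vol * \<psi>' ^ 4))"
    using G \<rho>' by (intro mult_right_mono) (auto simp: le_divide_eq C_def)
  also have "\<dots> = 8 * ball_vol * R * ((\<psi> / \<rho>) ^ 4 * (\<psi>' / \<rho>') ^ 4 + 16 * (\<rho>' / \<rho>) ^ 4 * (\<psi>' / \<rho>') ^ 4)"
    using G \<rho>' by (simp add: C_def power_divide field_simps)
  finally show ?thesis .
qed

section \<open>Unions of quasi-independent sets, partial sums and condensation\<close>

lemma measure_Union_Bonferroni:
  fixes E :: "nat \<Rightarrow> 'a set"
  assumes E: "\<And>i. E i \<in> fmeasurable M"
  shows "(\<Sum>i<n. measure M (E i)) - (\<Sum>j<n. \<Sum>i<j. measure M (E i \<inter> E j)) \<le> measure M (\<Union>i<n. E i)"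
proof (induction n)
  case (Suc n)
  have U: "(\<Union>i<n. E i) \<in> fmeasurable M"
    using E by (intro fmeasurable.finite_UN) auto
  have "measure M (\<Union>i<Suc n. E i) = measure M ((\<Union>i<n. E i) \<union> E n)"
    by (simp add: lessThan_Suc Un_commute)
  also have "\<dots> = measure M (\<Union>i<n. E i) + measure M (E n) - measure M ((\<Union>i<n. E i) \<inter> E n)"
    using U E by (rule measure_Un3)
  finally have eq: "measure M (\<Union>i<Suc n. E i)
      = measure M (\<Union>i<n. E i) + measure M (E n) - measure M ((\<Union>i<n. E i) \<inter> E n)" .
  have "measure M ((\<Union>i<n. E i) \<inter> E n) = measure M (\<Union>i<n. E i \<inter> E n)"
    by (rule arg_cong[where f = "measure M"]) blast
  also have "\<dots> \<le> (\<Sum>i<n. measure M (E i \<inter> E n))"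
    using E by (intro measure_UNION_le) auto
  finally show ?case
    using Suc.IH eq by simp
qed simp

lemma sum_power_diff_le:
  fixes x :: real
  assumes "0 \<le> x" "x \<le> 1/2"
  shows "(\<Sum>i<j. x ^ (j - i)) \<le> 2 * x"
proof (induction j)
  case 0
  then show ?case
    using assms by simp
next
  case (Suc j)
  have "(\<Sum>i<Suc j. x ^ (Suc j - i)) = x * (\<Sum>i<j. x ^ (j - i)) + x"
    by (simp add: sum_distrib_left Suc_diff_le less_imp_le)
  also have "\<dots> \<le> x * (2 * x) + x"
    using Suc assms by (intro add_right_mono mult_left_mono)
  also have "\<dots> \<le> x * (2 * (1/2)) + x"
    using assms by (intro add_right_mono mult_left_mono) auto
  finally show ?case
    by simp
qed

text \<open>In Bonferroni's inequality the products \<open>a i * a j\<close> sum to at most the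
  square of \<open>S k\<close>, and the geometric factors to at most \<open>2 * x\<close> for each
  \<open>j\<close>. For small \<open>x\<close> and small \<open>S k\<close> the linear term
  \<open>A * S k\<close> prevails.\<close>

lemma quasi_independent_union:
  fixes a :: "nat \<Rightarrow> real"
  assumes E: "\<And>i. E i \<in> fmeasurable M" and a: "\<And>i. 0 \<le> a i" and B: "0 \<le> B" and x: "0 \<le> x" "x \<le> 1/2"
    and lo: "\<And>i. A * a i \<le> measure M (E i)"
    and ov: "\<And>i j. i < j \<Longrightarrow> measure M (E i \<inter> E j) \<le> B * (a i * a j + 16 * x ^ (j - i) * a j)"
  defines "S \<equiv> \<lambda>k. \<Sum>i<k. a i"
  shows "A * S k - B * ((S k)\<^sup>2 + 32 * x * S k) \<le> measure M (\<Union>i<k. E i)"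
proof -
  have "(\<Sum>j<k. \<Sum>i<j. measure M (E i \<inter> E j))
      \<le> (\<Sum>j<k. \<Sum>i<j. B * (a i * a j + 16 * x ^ (j - i) * a j))"
    using ov by (intro sum_mono) auto
  also have "\<dots> = (\<Sum>j<k. B * (a j * S j + 16 * a j * (\<Sum>i<j. x ^ (j - i))))"
    by (simp add: S_def sum_distrib_left sum.distrib algebra_simps)
  also have "\<dots> \<le> (\<Sum>j<k. B * (a j * S k + 16 * a j * (2 * x)))"
    using a B sum_power_diff_le[OF x] unfolding S_def
    by (intro sum_mono mult_left_mono add_mono sum_mono2) auto
  also have "\<dots> = B * ((S k)\<^sup>2 + 32 * x * S k)"
    unfolding S_def power2_eq_square
    by (simp add: sum_distrib_left sum_distrib_right sum.distrib algebra_simps)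
  finally have "(\<Sum>j<k. \<Sum>i<j. measure M (E i \<inter> E j)) \<le> B * ((S k)\<^sup>2 + 32 * x * S k)" .
  moreover have "A * S k \<le> (\<Sum>i<k. measure M (E i))"
    unfolding S_def sum_distrib_left using lo by (intro sum_mono)
  ultimately show ?thesis
    using measure_Union_Bonferroni[of E M k, OF E] by linarith
qed

text \<open>The first partial sum from \<open>n\<close> on that reaches \<open>\<delta>\<close>
  exceeds it by at most its last term, which is at most \<open>\<delta>\<close>.\<close>

lemma nonsummable_partial_sum:
  fixes b :: "nat \<Rightarrow> real"
  assumes b: "\<And>n. 0 \<le> b n" "\<And>n. b n \<le> \<delta>" and ns: "\<not> summable b"
  obtains k where "\<delta> \<le> (\<Sum>i<k. b (n + i))" "(\<Sum>i<k. b (n + i)) \<le> 2 * \<delta>"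
proof -
  let ?P = "\<lambda>k. \<delta> \<le> (\<Sum>i<k. b (n + i))"
  have "\<exists>k. ?P k"
  proof (rule ccontr)
    assume "\<not> (\<exists>k. ?P k)"
    then have "summable (\<lambda>i. b (n + i))"
      using b(1) by (intro summableI_nonneg_bounded[where x = \<delta>]) (auto simp: not_le less_imp_le)
    then show False
      using ns summable_iff_shift[of b n] by (simp add: add.commute)
  qed
  then have L: "?P (Least ?P)"
    by (rule LeastI_ex)
  moreover have "(\<Sum>i<Least ?P. b (n + i)) \<le> 2 * \<delta>"
  proof (cases "Least ?P")
    case 0
    then show ?thesis
      using b[of 0] by simp
  next
    case (Suc k)
    then have "\<not> ?P k"
      using not_less_Least[of k ?P] by simp
    then show ?thesis
      using Suc b(2)[of "n + k"] by simp
  qed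
  ultimately show thesis
    by (rule that)
qed

text \<open>Cauchy condensation in base 128, the ratio of the denominator windows. A block has at
  most \<open>128 ^ Suc i\<close> terms, which raises the exponent 7 to 8, and \<open>\<Psi>\<close>
  is largest at its left end.\<close>

lemma condensation:
  fixes \<Psi> :: "nat \<Rightarrow> real"
  assumes pos: "\<And>m. m \<ge> 1 \<Longrightarrow> \<Psi> m > 0" and mono: "antimono_on {1..} \<Psi>"
    and sm: "summable (\<lambda>n. \<Psi> (128 ^ Suc n) ^ 4 * (128 ^ Suc n) ^ 8)"
  shows "summable (\<lambda>m. \<Psi> (Suc m) ^ 4 * real (Suc m) ^ 7)"
proof -
  define g where "g n = \<Psi> (128 ^ n) ^ 4 * (128 ^ n) ^ 8" for n
  define f where "f m = \<Psi> m ^ 4 * real m ^ 7" for m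
  have p8: "y * (p * y ^ 7) = p * y ^ 8" for y p :: real
    by (simp add: eval_nat_numeral)
  have f0: "0 \<le> f m" for m
    by (simp add: f_def zero_le_even_power)
  have g0: "0 \<le> g n" for n
    by (simp add: g_def zero_le_even_power)
  have sg: "summable g"
    using sm summable_Suc_iff[of g] by (simp add: g_def)
  have block: "(\<Sum>m\<in>{128 ^ i..<128 ^ Suc i}. f m) \<le> 128 ^ 8 * g i" for i
  proof -
    have "f m \<le> \<Psi> (128 ^ i) ^ 4 * (128 ^ Suc i) ^ 7" if m: "m \<in> {128 ^ i..<128 ^ Suc i}" for m
    proof -
      have "(1::nat) \<le> 128 ^ i"
        by simp
      then have m1: "1 \<le> m"
        using m by (meson atLeastLessThan_iff order_trans)
      have "\<Psi> m \<le> \<Psi> (128 ^ i)"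
        using mono m m1 by (auto simp: monotone_on_def)
      moreover have "real m \<le> 128 ^ Suc i"
        using m by (metis atLeastLessThan_iff less_imp_le of_nat_le_iff of_nat_numeral of_nat_power)
      ultimately show ?thesis
        unfolding f_def using pos[OF m1] by (intro mult_mono power_mono) auto
    qed
    then have "(\<Sum>m\<in>{128 ^ i..<128 ^ Suc i}. f m)
        \<le> real (card {128 ^ i..<128 ^ Suc i :: nat}) * (\<Psi> (128 ^ i) ^ 4 * (128 ^ Suc i) ^ 7)"
      by (rule sum_bounded_above)
    also have "\<dots> \<le> 128 ^ Suc i * (\<Psi> (128 ^ i) ^ 4 * (128 ^ Suc i) ^ 7)"
    proof (intro mult_right_mono)
      have "card {128 ^ i..<128 ^ Suc i :: nat} \<le> 128 ^ Suc i"
        by simp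
      then show "real (card {128 ^ i..<128 ^ Suc i :: nat}) \<le> 128 ^ Suc i"
        by (metis of_nat_le_iff of_nat_numeral of_nat_power)
    qed (simp add: zero_le_even_power)
    also have "\<dots> = \<Psi> (128 ^ i) ^ 4 * (128 ^ Suc i) ^ 8"
      by (rule p8)
    also have "\<dots> = 128 ^ 8 * g i"
      unfolding g_def power_Suc[of _ i] power_mult_distrib by simp
    finally show ?thesis .
  qed
  have blocks: "(\<Sum>m\<in>{1..<128 ^ n}. f m) \<le> 128 ^ 8 * (\<Sum>i<n. g i)" for n
  proof (induction n)
    case (Suc n)
    have "(1::nat) \<le> 128 ^ n" "(128::nat) ^ n \<le> 128 ^ Suc n"
      by simp_all
    then have "(\<Sum>m\<in>{1..<128 ^ Suc n}. f m) = (\<Sum>m\<in>{1..<128 ^ n}. f m) + (\<Sum>m\<in>{128 ^ n..<128 ^ Suc n}. f m)"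
      by (rule sum.atLeastLessThan_concat[symmetric])
    also have "\<dots> \<le> 128 ^ 8 * (\<Sum>i<n. g i) + 128 ^ 8 * g n"
      by (intro add_mono Suc block)
    also have "\<dots> = 128 ^ 8 * (\<Sum>i<Suc n. g i)"
      by (simp add: distrib_left)
    finally show ?case .
  qed simp
  have "summable (\<lambda>m. f (Suc m))"
  proof (rule summableI_nonneg_bounded)
    show "(\<Sum>m<n. f (Suc m)) \<le> 128 ^ 8 * suminf g" for n
    proof -
      have "n < 128 ^ n"
        by (rule less_le_trans[OF less_exp power_mono]) auto
      have "(\<Sum>m<n. f (Suc m)) = (\<Sum>m\<in>{1..<Suc n}. f m)"
        by (simp only: One_nat_def sum.atLeast_Suc_lessThan_Suc_shift lessThan_atLeast0 o_def)
      also have "\<dots> \<le> (\<Sum>m\<in>{1..<128 ^ n}. f m)"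
        using \<open>n < 128 ^ n\<close> f0 by (intro sum_mono2) auto
      also have "\<dots> \<le> 128 ^ 8 * (\<Sum>i<n. g i)"
        by (rule blocks)
      also have "\<dots> \<le> 128 ^ 8 * suminf g"
        using sum_le_suminf[OF sg] g0 by (intro mult_left_mono) auto
      finally show ?thesis .
    qed
  qed (rule f0)
  then show ?thesis
    by (simp add: f_def)
qed

section \<open>A fixed proportion of every small ball\<close>

text \<open>Tails for the limsup set \<open>W_set\<close>. They are open, hence measurable, and a
  point of \<open>resonant \<Psi> n\<close> for every \<open>n\<close> has approximations with
  arbitrarily large denominators, hence infinitely many.\<close>

definition resonant :: "(nat \<Rightarrow> real) \<Rightarrow> real \<Rightarrow> quat set"
  where "resonant \<Psi> T = (\<Union>(p, q)\<in>{(p, q). p \<in> Hurwitz \<and> q \<in> Hurwitz \<and> T < norm q}.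
    ball (p \<cdot>\<^sub>H qinv q) (real_ext \<Psi> (norm q)))"

lemma open_resonant: "open (resonant \<Psi> T)"
  unfolding resonant_def by (intro open_UN) auto

lemma Inter_resonant_subset_W_set: "(\<Inter>n. resonant \<Psi> (real n)) \<subseteq> W_set \<Psi>"
proof
  fix \<xi> assume \<xi>: "\<xi> \<in> (\<Inter>n. resonant \<Psi> (real n))"
  define P where "P = {(p, q). p \<in> Hurwitz \<and> q \<in> Hurwitz \<and> q \<noteq> 0 \<and>
    norm (\<xi> - p \<cdot>\<^sub>H qinv q) < real_ext \<Psi> (norm q)}"
  have "\<exists>pq\<in>P. real n < norm (snd pq)" for n
  proof -
    have "\<xi> \<in> resonant \<Psi> (real n)"
      using \<xi> by blast
    then obtain p q where pq: "p \<in> Hurwitz" "q \<in> Hurwitz" "real n < norm q"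
      "\<xi> \<in> ball (p \<cdot>\<^sub>H qinv q) (real_ext \<Psi> (norm q))"
      unfolding resonant_def by blast
    moreover have "q \<noteq> 0"
      using pq(3) by auto
    ultimately have "(p, q) \<in> P"
      by (simp add: P_def dist_norm norm_minus_commute)
    with pq(3) show ?thesis
      by force
  qed
  then have unb: "\<exists>x\<in>(norm \<circ> snd) ` P. real n < x" for n
    by simp
  have "infinite P"
  proof
    assume "finite P"
    then have "bdd_above ((norm \<circ> snd) ` P)"
      by simp
    then obtain K where K: "\<And>x. x \<in> (norm \<circ> snd) ` P \<Longrightarrow> x \<le> K"
      unfolding bdd_above_def by blast
    obtain n where "K < real n"
      using reals_Archimedean2 by blast
    with unb[of n] K show False
      by force
  qed
  then show "\<xi> \<in> W_set \<Psi>"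
    by (simp add: W_set_def P_def)
qed

lemma resonant_ball_measure:
  fixes \<Psi> :: "nat \<Rightarrow> real"
  assumes pos: "\<And>m. m \<ge> 1 \<Longrightarrow> \<Psi> m > 0" and mono: "antimono_on {1..} \<Psi>"
    and div: "\<not> summable (\<lambda>m. \<Psi> (Suc m) ^ 4 * real (Suc m) ^ 7)"
    and r: "0 < r" "r \<le> 1"
  shows "ball_vol * r ^ 4 / 10 ^ 10 \<le> measure lebesgue (ball z r \<inter> resonant \<Psi> T)"
proof -
  define \<rho> :: "nat \<Rightarrow> real" where "\<rho> n = 512 / (128 ^ Suc n)\<^sup>2" for n
  \<comment> \<open>Capping at \<open>\<rho> n / 100\<close> keeps every term of \<open>b\<close> small, so that some partial sum \<open>S\<close> is
    about \<open>1 / 200000\<close>: then in the Bonferroni bound the quadratic term \<open>8 * S\<^sup>2\<close> does not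
    swallow the linear term \<open>S / 2592\<close>.\<close>
  define \<psi> where "\<psi> n = min (\<Psi> (128 ^ Suc n)) (\<rho> n / 100)" for n
  define b where "b n = (\<psi> n / \<rho> n) ^ 4" for n
  have \<rho>0: "0 < \<rho> n" for n
    by (simp add: \<rho>_def)
  have \<psi>0: "0 < \<psi> n" for n
    using pos[of "128 ^ Suc n"] \<rho>0[of n] by (simp add: \<psi>_def)
  have \<psi>\<rho>: "\<psi> n / \<rho> n \<le> 1 / 100" "\<psi> n \<le> \<rho> n" for n
    using \<rho>0[of n] by (simp_all add: \<psi>_def divide_le_eq min_le_iff_disj)
  have b0: "0 \<le> b n" for n
    by (simp add: b_def)
  have b1: "b n \<le> 1 / 200000" for n
  proof -
    have "b n \<le> (1 / 100) ^ 4"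
      unfolding b_def using \<psi>\<rho>(1)[of n] \<psi>0[of n] \<rho>0[of n] by (intro power_mono) auto
    also have "\<dots> \<le> 1 / 200000"
      by (simp add: power_divide)
    finally show ?thesis .
  qed
  have nsb: "\<not> summable b"
  proof
    assume sb: "summable b"
    then have "b \<longlonglongrightarrow> 0"
      by (rule summable_LIMSEQ_zero)
    \<comment> \<open>Once \<open>b n\<close> is below \<open>(1 / 100) ^ 4\<close> the cap is
      inactive, so \<open>512 ^ 4 * b n\<close> is the term of the condensed series.\<close>
    then have "\<forall>\<^sub>F n in sequentially. b n < (1 / 100) ^ 4"
      by (rule order_tendstoD) simp
    then have "\<forall>\<^sub>F n in sequentially. \<Psi> (128 ^ Suc n) ^ 4 * (128 ^ Suc n) ^ 8 = 512 ^ 4 * b n"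
    proof eventually_elim
      case (elim n)
      have "\<psi> n \<noteq> \<rho> n / 100"
      proof
        assume "\<psi> n = \<rho> n / 100"
        then have "\<psi> n / \<rho> n = 1 / 100"
          using \<rho>0[of n] by simp
        with elim show False
          unfolding b_def by simp
      qed
      then have "\<psi> n = \<Psi> (128 ^ Suc n)"
        by (simp add: \<psi>_def min_def split: if_splits)
      then have "b n = (\<Psi> (128 ^ Suc n) * (128 ^ Suc n)\<^sup>2 / 512) ^ 4"
        by (simp only: b_def \<rho>_def divide_divide_eq_right)
      also have "\<dots> = \<Psi> (128 ^ Suc n) ^ 4 * (128 ^ Suc n) ^ 8 / 512 ^ 4"
        unfolding power_divide power_mult_distrib by (simp flip: power_mult)
      finally show ?case
        by simp
    qed
    then have "summable (\<lambda>n. \<Psi> (128 ^ Suc n) ^ 4 * (128 ^ Suc n) ^ 8)"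
      by (rule iffD2[OF summable_cong summable_mult[OF sb]])
    then show False
      using condensation[OF pos mono] div by blast
  qed
  \<comment> \<open>Starting at \<open>n0\<close> serves two ends: \<open>N\<close> is large enough
    for \<open>separated_layer\<close>, and the denominators of each level, which exceed
    \<open>N / 128\<close>, exceed \<open>T\<close>.\<close>
  obtain n0 where n0: "max (128 / r\<^sup>2) T < 128 ^ n0"
    using real_arch_pow[of 128 "max (128 / r\<^sup>2) T"] by auto
  define m where "m i = n0 + i" for i
  have "\<exists>G. finite G \<and> G \<subseteq> good_centres z r (128 ^ Suc (m i)) \<and>
      (\<forall>x\<in>G. \<forall>y\<in>G. x \<noteq> y \<longrightarrow> 2 * \<rho> (m i) \<le> dist x y) \<and>
      r ^ 4 / 2592 \<le> real (card G) * \<rho> (m i) ^ 4 \<and> real (card G) * \<rho> (m i) ^ 4 \<le> r ^ 4 \<and> \<rho> (m i) \<le> r / 4" for i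
  proof -
    have eq: "2 * real (64 * 128 ^ m i) = 128 ^ Suc (m i)"
      by simp
    have "(128::real) ^ n0 \<le> 128 ^ Suc (m i)"
      unfolding m_def by (rule power_increasing) auto
    then have "128 / r\<^sup>2 \<le> 2 * real (64 * 128 ^ m i)"
      unfolding eq using n0 by linarith
    from separated_layer[OF r this, of z, unfolded eq, folded \<rho>_def]
    show ?thesis
      by (metis (no_types, lifting))
  qed
  then obtain G where G: "\<And>i. finite (G i)" "\<And>i. G i \<subseteq> good_centres z r (128 ^ Suc (m i))"
    "\<And>i x y. x \<in> G i \<Longrightarrow> y \<in> G i \<Longrightarrow> x \<noteq> y \<Longrightarrow> 2 * \<rho> (m i) \<le> dist x y"
    "\<And>i. r ^ 4 / 2592 \<le> real (card (G i)) * \<rho> (m i) ^ 4"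
    "\<And>i. real (card (G i)) * \<rho> (m i) ^ 4 \<le> r ^ 4" "\<And>i. \<rho> (m i) \<le> r / 4"
    by metis
  define E where "E i = (\<Union>g\<in>G i. ball g (\<psi> (m i)))" for i
  have Em: "E i \<in> lmeasurable" for i
    unfolding E_def using G(1) by (intro fmeasurable.finite_UN) auto
  have Esub: "E i \<subseteq> ball z r \<inter> resonant \<Psi> T" for i
  proof
    fix y assume "y \<in> E i"
    then obtain g where g: "g \<in> G i" "dist g y < \<psi> (m i)"
      by (auto simp: E_def)
    then obtain p q where pq: "g = p \<cdot>\<^sub>H qinv q" "p \<in> Hurwitz" "q \<in> Hurwitz"
      "128 ^ Suc (m i) / 128 < norm q" "norm q \<le> 128 ^ Suc (m i)" "dist z g < 3 / 4 * r"
      using G(2)[of i] unfolding good_centres_def by (auto simp del: power_Suc)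
    have "dist g y < r / 4"
      using g(2) \<psi>\<rho>(2)[of "m i"] G(6)[of i] by linarith
    then have yz: "dist z y < r"
      using pq(6) by metric
    have "(128::real) ^ n0 \<le> 128 ^ m i"
      unfolding m_def by (rule power_increasing) auto
    moreover have "(128::real) ^ m i < norm q"
      using pq(4) by simp
    ultimately have T: "T < norm q"
      using n0 by linarith
    have "1 \<le> norm q"
      using pq(3,4) by (intro Hurwitz_norm_ge_1) (auto simp: not_less)
    then have "1 \<le> nat \<lfloor>norm q\<rfloor>"
      by (simp add: le_nat_iff le_floor_iff)
    moreover have "nat \<lfloor>norm q\<rfloor> \<le> 128 ^ Suc (m i)"
    proof -
      have "norm q < of_int (128 ^ Suc (m i)) + 1"
        using pq(5) by simp
      then have "\<lfloor>norm q\<rfloor> \<le> 128 ^ Suc (m i)"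
        by (simp only: floor_le_iff)
      then show ?thesis
        by (simp add: nat_le_iff)
    qed
    \<comment> \<open>The value of \<open>\<Psi>\<close> at the top of the level is at most its
      value at any denominator of the level, so one radius is admissible for all centres.\<close>
    ultimately have "\<Psi> (128 ^ Suc (m i)) \<le> real_ext \<Psi> (norm q)"
      using mono unfolding monotone_on_def real_ext_def by (auto simp del: power_Suc)
    then have "dist g y < real_ext \<Psi> (norm q)"
      using g(2) unfolding \<psi>_def by linarith
    then show "y \<in> ball z r \<inter> resonant \<Psi> T"
      using yz T pq(1-3) unfolding resonant_def by auto
  qed
  have lo: "(ball_vol * r ^ 4 / 2592) * b (m i) \<le> measure lebesgue (E i)" for i
  proof -
    have "measure lebesgue (E i) = real (card (G i)) * (ball_vol * \<psi> (m i) ^ 4)"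
      unfolding E_def
      by (rule separated_layer_measure[OF G(1) G(3)])
        (use \<psi>0[of "m i"] \<psi>\<rho>(2)[of "m i"] in auto)
    also have "\<dots> = real (card (G i)) * \<rho> (m i) ^ 4 * (ball_vol * b (m i))"
      using \<rho>0[of "m i"] by (simp add: b_def power_divide)
    also have "\<dots> \<ge> r ^ 4 / 2592 * (ball_vol * b (m i))"
      using b0 G(4) by (intro mult_right_mono) auto
    finally show ?thesis
      by (simp add: mult_ac)
  qed
  \<comment> \<open>Consecutive radii \<open>\<rho>\<close> have ratio \<open>1 / 128 ^ 2\<close>;
    \<open>x\<close> is its fourth power.\<close>
  define x :: real where "x = 1 / 128 ^ 8"
  have ov: "measure lebesgue (E i \<inter> E j)
      \<le> (8 * ball_vol * r ^ 4) * (b (m i) * b (m j) + 16 * x ^ (j - i) * b (m j))" if ij: "i < j" for i j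
  proof -
    have "128 ^ Suc (m j) = 128 ^ Suc (m i) * (128::real) ^ (j - i)"
      using ij by (simp add: m_def flip: power_add)
    then have "\<rho> (m j) = \<rho> (m i) / (128 ^ (j - i))\<^sup>2"
      unfolding \<rho>_def by (simp only: power_mult_distrib divide_divide_eq_left)
    then have "\<rho> (m j) / \<rho> (m i) = 1 / (128 ^ (j - i))\<^sup>2"
      using \<rho>0[of "m i"] by simp
    then have "(\<rho> (m j) / \<rho> (m i)) ^ 4 = x ^ (j - i)"
      unfolding x_def power_one_over by (simp only: power_divide power_one mult.commute flip: power_mult) simp
    moreover have "measure lebesgue (E i \<inter> E j) \<le> 8 * ball_vol * r ^ 4 *
        (b (m i) * b (m j) + 16 * (\<rho> (m j) / \<rho> (m i)) ^ 4 * b (m j))"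
      unfolding E_def b_def using \<psi>0 \<psi>\<rho>(2)
      by (intro separated_layers_overlap G \<rho>0) (auto simp: less_imp_le)
    ultimately show ?thesis
      by simp
  qed
  obtain k where k: "1 / 200000 \<le> (\<Sum>i<k. b (m i))" "(\<Sum>i<k. b (m i)) \<le> 2 * (1 / 200000)"
    using nonsummable_partial_sum[OF b0 b1 nsb, of n0] unfolding m_def by blast
  define S where "S = (\<Sum>i<k. b (m i))"
  have S: "1 / 200000 \<le> S" "S \<le> 1 / 100000"
    using k by (simp_all add: S_def)
  have x: "0 \<le> x" "x \<le> 1 / 1000000000"
    by (simp_all add: x_def)
  have "(ball_vol * r ^ 4 / 2592) * S - (8 * ball_vol * r ^ 4) * (S\<^sup>2 + 32 * x * S)
      \<le> measure lebesgue (\<Union>i<k. E i)"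
    unfolding S_def by (rule quasi_independent_union[OF Em b0 _ _ _ lo ov]) (use x r in auto)
  also have "\<dots> \<le> measure lebesgue (ball z r \<inter> resonant \<Psi> T)"
    using Esub by (intro measure_mono_fmeasurable fmeasurableD[OF fmeasurable.finite_UN] Em lmeasurable_open)
      (auto intro: open_resonant bounded_Int)
  finally have m1: "(ball_vol * r ^ 4) * (S * (1 / 2592 - 8 * S - 256 * x))
      \<le> measure lebesgue (ball z r \<inter> resonant \<Psi> T)"
    by (simp add: algebra_simps power2_eq_square)
  \<comment> \<open>Here \<open>1 / 2592 > 0.00038\<close>, while \<open>8 * S \<le> 0.00008\<close>
    and \<open>256 * x < 0.000001\<close>, so the bracket exceeds 1 / 10000.\<close>
  have "1 / 200000 * (1 / 10000) \<le> S * (1 / 2592 - 8 * S - 256 * x)"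
    using S x by (intro mult_mono) auto
  then have m2: "(ball_vol * r ^ 4) * (1 / 200000 * (1 / 10000))
      \<le> (ball_vol * r ^ 4) * (S * (1 / 2592 - 8 * S - 256 * x))"
    using r by (intro mult_left_mono) auto
  have "ball_vol * r ^ 4 / 10 ^ 10 \<le> (ball_vol * r ^ 4) * (1 / 200000 * (1 / 10000))"
    using r by simp
  also note m2
  also note m1
  finally show ?thesis .
qed

section \<open>From a fixed proportion of every small ball to full measure\<close>

text \<open>A substitute for the Lebesgue density theorem, by Vitali's covering theorem inside an open
  set that is only slightly larger than \<open>F\<close>.\<close>
lemma null_set_of_ball_deficit:
  fixes F :: "'a :: euclidean_space set"
  assumes F: "F \<in> lmeasurable" and c: "0 < c"
    and deficit: "\<And>z r. 0 < r \<Longrightarrow> r \<le> 1 \<Longrightarrow>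
      measure lebesgue (F \<inter> ball z r) \<le> (1 - c) * measure lebesgue (ball z r)"
  shows "F \<in> null_sets lebesgue"
proof (rule ccontr)
  let ?\<mu> = "measure lebesgue"
  assume "F \<notin> null_sets lebesgue"
  then have F0: "0 < ?\<mu> F"
    using F by (metis completion.complete_sets_sandwich_fmeasurable fmeasurableD measure_eq_0_null_sets
        zero_less_measure_iff negligible_iff_measure0 negligible_iff_null_sets)
  have "0 < c * ?\<mu> F"
    using F0 c by simp
  then obtain U where U: "open U" "F \<subseteq> U" "U - F \<in> lmeasurable" "emeasure lebesgue (U - F) < ennreal (c * ?\<mu> F)"
    using sets_lebesgue_outer_open[OF fmeasurableD[OF F]] by metis
  have Um: "U \<in> lmeasurable"
    using fmeasurable.Un[OF F U(3)] U(2) by (simp add: Un_absorb1)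
  have "?\<mu> (U - F) < c * ?\<mu> F"
    using U(3,4) \<open>0 < c * ?\<mu> F\<close> by (simp add: emeasure_eq_measure2 ennreal_less_iff del: measure_completion emeasure_completion)
  moreover have "?\<mu> (U - F) = ?\<mu> U - ?\<mu> F"
    using Um F U(2) by (intro measurable_measure_Diff) auto
  ultimately have mU: "?\<mu> U < (1 + c) * ?\<mu> F"
    by (simp add: algebra_simps)
  define K where "K = {(x :: 'a, r :: real). 0 < r \<and> r \<le> 1 \<and> ball x r \<subseteq> U}"
  obtain C where C: "countable C" "C \<subseteq> K"
    "pairwise (\<lambda>i j. disjnt (ball (fst i) (snd i)) (ball (fst j) (snd j))) C"
    "negligible (F - (\<Union>i\<in>C. ball (fst i) (snd i)))"
  proof (rule Vitali_covering_theorem_balls[of F K fst snd])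
    fix x and d :: real assume "x \<in> F" "0 < d"
    then obtain e where e: "0 < e" "ball x e \<subseteq> U"
      using U by (meson openE subsetD)
    \<comment> \<open>The three bounds keep the ball inside \<open>U\<close>, its radius strictly
      below \<open>d\<close>, and the radius in the range of the deficit hypothesis.\<close>
    define s where "s = min (min e (d / 2)) 1"
    have "0 < s" "s \<le> 1" "s \<le> e" "s < d"
      using e \<open>0 < d\<close> by (auto simp: s_def)
    then have "(x, s) \<in> K"
      using e by (auto simp: K_def)
    then show "\<exists>i. i \<in> K \<and> x \<in> ball (fst i) (snd i) \<and> snd i < d"
      using \<open>0 < s\<close> \<open>s < d\<close> by (intro exI[of _ "(x, s)"]) auto
  qed
  let ?B = "\<lambda>i :: 'a \<times> real. ball (fst i) (snd i)"
  \<comment> \<open>The deficit of a unit ball forces \<open>c \<le> 1\<close>, so that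
    multiplication by \<open>1 - c\<close> preserves inequalities.\<close>
  have "0 \<le> (1 - c) * ?\<mu> (ball 0 1 :: 'a set)"
    using deficit[of 1 0] measure_nonneg[of lebesgue "F \<inter> ball 0 1"] by linarith
  moreover have "0 < ?\<mu> (ball 0 1 :: 'a set)"
    by simp
  ultimately have c1: "0 \<le> 1 - c"
    by (meson not_le mult_neg_pos)
  have FB: "F \<inter> ?B i \<in> lmeasurable" for i
    using F by (intro fmeasurable_Int_fmeasurable) auto
  \<comment> \<open>A bound uniform over finite subfamilies passes to the countable union over
    \<open>C\<close>.\<close>
  have bound: "?\<mu> (\<Union>i\<in>D. F \<inter> ?B i) \<le> (1 - c) * ?\<mu> U" if D: "D \<subseteq> C" "finite D" for D
  proof -
    have "?\<mu> (\<Union>i\<in>D. F \<inter> ?B i) \<le> (\<Sum>i\<in>D. ?\<mu> (F \<inter> ?B i))"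
      using FB D by (intro measure_UNION_le) auto
    also have "\<dots> \<le> (\<Sum>i\<in>D. (1 - c) * ?\<mu> (?B i))"
      using C(2) D(1) by (intro sum_mono deficit) (auto simp: K_def)
    also have "\<dots> = (1 - c) * ?\<mu> (\<Union>i\<in>D. ?B i)"
      using D(2) pairwise_subset[OF C(3) D(1)]
      by (subst measure_UNION') (auto simp: sum_distrib_left simp del: measure_completion)
    also have "\<dots> \<le> (1 - c) * ?\<mu> U"
    proof (intro mult_left_mono[OF _ c1] measure_mono_fmeasurable Um)
      show "(\<Union>i\<in>D. ?B i) \<subseteq> U"
      proof (rule UN_least)
        fix i assume "i \<in> D"
        then have "i \<in> K"
          using C(2) D(1) by blast
        then show "?B i \<subseteq> U"
          by (simp add: K_def case_prod_beta)
      qed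
      show "(\<Union>i\<in>D. ?B i) \<in> sets lebesgue"
        using D(2) by auto
    qed
    finally show ?thesis .
  qed
  have "?\<mu> ((\<Union>i\<in>C. F \<inter> ?B i) \<union> (F - (\<Union>i\<in>C. ?B i))) = ?\<mu> (\<Union>i\<in>C. F \<inter> ?B i)"
  proof (rule measure_Un_null_set)
    show "(\<Union>i\<in>C. F \<inter> ?B i) \<in> sets lebesgue"
      by (rule fmeasurableD[OF fmeasurable_UN_bound[OF C(1) FB bound]])
    show "F - (\<Union>i\<in>C. ?B i) \<in> null_sets lebesgue"
      using C(4) by (simp only: negligible_iff_null_sets)
  qed
  moreover have "(\<Union>i\<in>C. F \<inter> ?B i) \<union> (F - (\<Union>i\<in>C. ?B i)) = F"
    by blast
  moreover have "?\<mu> (\<Union>i\<in>C. F \<inter> ?B i) \<le> (1 - c) * ?\<mu> U"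
    by (rule measure_UN_bound[OF C(1) FB bound])
  ultimately have "?\<mu> F \<le> (1 - c) * ?\<mu> U"
    by (simp only:)
  also have "\<dots> \<le> (1 - c) * ((1 + c) * ?\<mu> F)"
    using mU c1 by (intro mult_left_mono) auto
  also have "\<dots> = ?\<mu> F - c\<^sup>2 * ?\<mu> F"
    by (simp add: algebra_simps power2_eq_square)
  finally show False
    using F0 c by (simp add: mult_le_0_iff not_le)
qed

text \<open>\<open>resonant_ball_measure\<close> is a deficit, with \<open>c = 1 / 10 ^ 10\<close>,
  for the complement of each tail. Cutting with \<open>ball 0 k\<close> makes that complement of
  finite measure, and countably many null sets then cover the complement of
  \<open>W_set\<close>.\<close>

lemma Compl_W_set_null:
  fixes \<Psi> :: "nat \<Rightarrow> real"
  assumes pos: "\<And>m. m \<ge> 1 \<Longrightarrow> \<Psi> m > 0" and mono: "antimono_on {1..} \<Psi>"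
    and div: "\<not> summable (\<lambda>m. \<Psi> (Suc m) ^ 4 * real (Suc m) ^ 7)"
  shows "- W_set \<Psi> \<in> null_sets lebesgue"
proof -
  have "ball 0 (real k) - resonant \<Psi> (real n) \<in> null_sets lebesgue" for k n
  proof (rule null_set_of_ball_deficit)
    let ?R = "resonant \<Psi> (real n)"
    have R: "?R \<in> sets lebesgue"
      using open_resonant by (intro sets_completionI_sets) auto
    show F: "ball 0 (real k) - ?R \<in> lmeasurable"
      using R by (intro fmeasurable_Diff) auto
    show "0 < (1 / 10 ^ 10 :: real)"
      by simp
    fix z :: quat and r :: real assume r: "0 < r" "r \<le> 1"
    have BR: "ball z r \<inter> ?R \<in> lmeasurable"
      using open_resonant by (intro lmeasurable_open) (auto intro: bounded_Int)
    have "measure lebesgue ((ball 0 (real k) - ?R) \<inter> ball z r) \<le> measure lebesgue (ball z r - (ball z r \<inter> ?R))"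
      using F BR by (intro measure_mono_fmeasurable fmeasurable_Diff) auto
    also have "\<dots> = measure lebesgue (ball z r) - measure lebesgue (ball z r \<inter> ?R)"
      using BR by (intro measurable_measure_Diff) auto
    also have "\<dots> \<le> measure lebesgue (ball z r) - ball_vol * r ^ 4 / 10 ^ 10"
      using resonant_ball_measure[OF pos mono div r] by simp
    also have "\<dots> = (1 - 1 / 10 ^ 10) * measure lebesgue (ball z r)"
      using r by (simp add: measure_quat_ball algebra_simps del: measure_completion)
    finally show "measure lebesgue ((ball 0 (real k) - ?R) \<inter> ball z r)
        \<le> (1 - 1 / 10 ^ 10) * measure lebesgue (ball z r)" .
  qed
  then have "(\<Union>n. \<Union>k. ball 0 (real k) - resonant \<Psi> (real n)) \<in> null_sets lebesgue"
    by (intro null_sets_UN)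
  moreover have "- W_set \<Psi> \<subseteq> (\<Union>n. \<Union>k. ball 0 (real k) - resonant \<Psi> (real n))"
  proof
    fix \<xi> assume "\<xi> \<in> - W_set \<Psi>"
    then obtain n where "\<xi> \<notin> resonant \<Psi> (real n)"
      using Inter_resonant_subset_W_set by blast
    moreover obtain k where "norm \<xi> < real k"
      using reals_Archimedean2 by blast
    ultimately show "\<xi> \<in> (\<Union>n. \<Union>k. ball 0 (real k) - resonant \<Psi> (real n))"
      by auto
  qed
  ultimately show ?thesis
    by (rule null_sets_completion_subset[rotated])
qed

theorem theorem6p1:
  fixes \<Psi> :: "nat \<Rightarrow> real"
  assumes "\<And>m. m \<ge> 1 \<Longrightarrow> \<Psi> m > 0"
  shows "(summable (\<lambda>m. \<Psi> (Suc m) ^ 4 * real (Suc m) ^ 7) \<longrightarrow>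
            W_set \<Psi> \<in> null_sets lebesgue \<and> V_set \<Psi> \<in> null_sets lebesgue) \<and>
         (antimono_on {1..} \<Psi> \<and> \<not> summable (\<lambda>m. \<Psi> (Suc m) ^ 4 * real (Suc m) ^ 7) \<longrightarrow>
            full_in (W_set \<Psi>) UNIV \<and> full_in (V_set \<Psi>) Delta_bar)"
proof (intro conjI impI; (elim conjE)?)
  assume sm: "summable (\<lambda>m. \<Psi> (Suc m) ^ 4 * real (Suc m) ^ 7)"
  show "W_set \<Psi> \<in> null_sets lebesgue"
    using assms sm by (rule W_set_null)
  then show "V_set \<Psi> \<in> null_sets lebesgue"
    by (rule null_sets_completion_subset[rotated]) (simp add: V_set_def)
next
  assume *: "antimono_on {1..} \<Psi>" "\<not> summable (\<lambda>m. \<Psi> (Suc m) ^ 4 * real (Suc m) ^ 7)"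
  have null: "- W_set \<Psi> \<in> null_sets lebesgue"
    using assms * by (rule Compl_W_set_null)
  then show "full_in (W_set \<Psi>) UNIV"
    by (simp add: full_in_def Compl_eq_Diff_UNIV)
  have "Delta_bar - V_set \<Psi> \<in> null_sets lebesgue"
    by (rule null_sets_completion_subset[OF _ null]) (auto simp: V_set_def)
  then show "full_in (V_set \<Psi>) Delta_bar"
    by (simp add: full_in_def V_set_def)
qed

end
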